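(* The functor $\overline{\mathbb T}:\mathbf{HDA}^\Sigma\to\mathbf{WHDTS}$ is not full.
   Context: $\Sigma$ is a fixed nonempty set of labels. A weak higher dimensional transition system is a triple $(S,\mu:L\to\Sigma,T=\bigcup_{n\ge1}T_n)$ with $S$ a set (states), $L$ a set (actions), $\mu$ a set map (labelling map) and $T_n\subset S\times L^n\times S$ ($n$-transitions) such that: - (Multiset axiom) for every permutation $\sigma$ of $\{1,\dots,n\}$, $n\ge2$, if $(\alpha,u_1,\dots,u_n,\beta)\in T$ then $(\alpha,u_{\sigma(1)},\dots,u_{\sigma(n)},\beta)\in T$; - (Coherence axiom) for $n\ge3$, $p,q\ge1$ with $p+q<n$, if $(\alpha,u_1,\dots,u_n,\beta)$, $(\alpha,u_1,\dots,u_p,\nu_1)$, $(\nu_1,u_{p+1},\dots,u_n,\beta)$, $(\alpha,u_1,\dots,u_{p+q},\nu_2)$, $(\nu_2,u_{p+q+1},\dots,u_n,\beta)$ are transitions, then $(\nu_1,u_{p+1},\dots,u_{p+q},\nu_2)$ is a transition. A morphism $f$ consists of a map $f_0$ on states and a map $\widetilde f$ on actions commuting with the labelling maps, such that $(f_0(\alpha),\widetilde f(u_1),\dots,\widetilde f(u_n),f_0(\beta))$ is a transition whenever $(\alpha,u_1,\dots,u_n,\beta)$ is. The category is $\mathbf{WHDTS}$. $C_n[a_1,\dots,a_n]$ ($n\ge0$, $a_i\in\Sigma$) has set of states $\{0,1\}^n$, set of actions $\{(a_1,1),\dots,(a_n,n)\}$, labelling $\mu(a_i,i)=a_i$, and its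 $d$-transitions ($d\ge1$) are the tuples $((\epsilon_1,\dots,\epsilon_n),(a_{i_1},i_1),\dots,(a_{i_d},i_d),(\epsilon_1',\dots,\epsilon_n'))$ with $i_1,\dots,i_d$ pairwise distinct, $\epsilon_i\le\epsilon_i'$ for all $i$, and $\epsilon_i\ne\epsilon_i'$ iff $i\in\{i_1,\dots,i_d\}$. $\square_S$ is the category with objects $[n]=\{0,1\}^n$, $n\ge0$, whose morphisms are the set maps generated by the face maps $\delta_i^\alpha(\epsilon_1,\dots,\epsilon_{n-1})=(\epsilon_1,\dots,\epsilon_{i-1},\alpha,\epsilon_i,\dots,\epsilon_{n-1})$ ($\alpha\in\{0,1\}$) and the symmetry maps $\sigma_i:[n]\to[n]$ exchanging coordinates $i$ and $i+1$. A symmetric precubical set is a presheaf on $\square_S$; $\square_S[n]=\square_S(-,[n])$; $\partial\square_S[n]\subset\square_S[n]$ has the same $k$-cubes for $k<n$ and none for $k\ge n$. The symmetric precubical set $!^S\Sigma$ has $(!^S\Sigma)_n=\Sigma^n$, where $(\delta_i^0)^*=(\delta_i^1)^*$ removes the $i$-th letter and $\sigma_i^*$ exchanges letters $i$ and $i+1$. A labelled symmetric precubical set is an object of the comma category $\square_S^{op}\mathbf{Set}\downarrow{!^S\Sigma}$. The labelled cube $\square_S[a_1,\dots,a_n]$ is $\square_S[n]\to{!^S\Sigma}$ corresponding to $(a_1,\dots,a_n)\in\Sigma^n$. $\mathbb T:\square_S^{op}\mathbf{Set}\downarrow{!^S\Sigma}\to\mathbf{WHDTS}$ is the colimit-preserving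 functor with $\mathbb T(\square_S[a_1,\dots,a_n])=C_n[a_1,\dots,a_n]$ and defined on a map of cubes $f:\square_S[a_1,\dots,a_m]\to\square_S[b_1,\dots,b_n]$ as follows: on states it is $f_0:[m]\to[n]$; there is a unique $\widehat f:\{1,\dots,n\}\to\{1,\dots,m\}\cup\{-\infty,+\infty\}$ with $f_0(\epsilon_1,\dots,\epsilon_m)=(\epsilon_{\widehat f(1)},\dots,\epsilon_{\widehat f(n)})$ (with $\epsilon_{-\infty}=0$, $\epsilon_{+\infty}=1$), each $i\in\{1,\dots,m\}$ has exactly one preimage $j$ under $\widehat f$, and on actions $(a_i,i)\mapsto(b_j,j)=(a_i,j)$. A labelled symmetric precubical set $K\to{!^S\Sigma}$ satisfies the HDA paradigm if for every $p\ge2$, every commutative square with sides $\partial\square_S[p]\subset\square_S[p]$, $\partial\square_S[p]\to K$, $\square_S[p]\to{!^S\Sigma}$ and $K\to{!^S\Sigma}$ admits at most one lift $k:\square_S[p]\to K$. $\mathbf{HDA}^\Sigma$ is the full subcategory of such objects, and $\overline{\mathbb T}$ is the restriction of $\mathbb T$ to $\mathbf{HDA}^\Sigma$. *)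

theory Defs
  imports "HOL-Library.FuncSet" "HOL-Combinatorics.Permutations"
begin

section \<open>Categories and functors\<close>

text \<open>
  Since arrows need not determine their source and target, hom-sets and composition
  take the objects as arguments: \<open>Comp C X Y Z g f\<close> is \<open>g\<close> after \<open>f\<close> for
  \<open>f \<in> Hom C X Y\<close>, \<open>g \<in> Hom C Y Z\<close>.
\<close>

record ('o, 'm) category =
  Obj :: "'o set"
  Hom :: "'o \<Rightarrow> 'o \<Rightarrow> 'm set"
  Idn :: "'o \<Rightarrow> 'm"
  Comp :: "'o \<Rightarrow> 'o \<Rightarrow> 'o \<Rightarrow> 'm \<Rightarrow> 'm \<Rightarrow> 'm"

definition is_category :: "('o, 'm) category \<Rightarrow> bool" where
  "is_category C \<longleftrightarrow>
     (\<forall>X\<in>Obj C. Idn C X \<in> Hom C X X) \<and>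
     (\<forall>X\<in>Obj C. \<forall>Y\<in>Obj C. \<forall>Z\<in>Obj C. \<forall>f\<in>Hom C X Y. \<forall>g\<in>Hom C Y Z.
        Comp C X Y Z g f \<in> Hom C X Z) \<and>
     (\<forall>X\<in>Obj C. \<forall>Y\<in>Obj C. \<forall>f\<in>Hom C X Y.
        Comp C X X Y f (Idn C X) = f \<and> Comp C X Y Y (Idn C Y) f = f) \<and>
     (\<forall>W\<in>Obj C. \<forall>X\<in>Obj C. \<forall>Y\<in>Obj C. \<forall>Z\<in>Obj C.
        \<forall>f\<in>Hom C W X. \<forall>g\<in>Hom C X Y. \<forall>h\<in>Hom C Y Z.
          Comp C W X Z (Comp C X Y Z h g) f = Comp C W Y Z h (Comp C W X Y g f))"

record ('o, 'm, 'p, 'n) funct =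
  on_obj :: "'o \<Rightarrow> 'p"
  on_hom :: "'o \<Rightarrow> 'o \<Rightarrow> 'm \<Rightarrow> 'n"

definition is_functor ::
    "('o, 'm) category \<Rightarrow> ('p, 'n) category \<Rightarrow> ('o, 'm, 'p, 'n) funct \<Rightarrow> bool" where
  "is_functor C D F \<longleftrightarrow>
     (\<forall>X\<in>Obj C. on_obj F X \<in> Obj D) \<and>
     (\<forall>X\<in>Obj C. \<forall>Y\<in>Obj C. \<forall>f\<in>Hom C X Y.
        on_hom F X Y f \<in> Hom D (on_obj F X) (on_obj F Y)) \<and>
     (\<forall>X\<in>Obj C. on_hom F X X (Idn C X) = Idn D (on_obj F X)) \<and>
     (\<forall>X\<in>Obj C. \<forall>Y\<in>Obj C. \<forall>Z\<in>Obj C. \<forall>f\<in>Hom C X Y. \<forall>g\<in>Hom C Y Z.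
        on_hom F X Z (Comp C X Y Z g f)
        = Comp D (on_obj F X) (on_obj F Y) (on_obj F Z) (on_hom F Y Z g) (on_hom F X Y f))"

definition is_full ::
    "('o, 'm) category \<Rightarrow> ('p, 'n) category \<Rightarrow> ('o, 'm, 'p, 'n) funct \<Rightarrow> bool" where
  "is_full C D F \<longleftrightarrow>
     (\<forall>X\<in>Obj C. \<forall>Y\<in>Obj C. \<forall>g\<in>Hom D (on_obj F X) (on_obj F Y).
        \<exists>f\<in>Hom C X Y. on_hom F X Y f = g)"

definition full_subcategory ::
    "('o, 'm) category \<Rightarrow> ('o \<Rightarrow> bool) \<Rightarrow> ('o, 'm) category" where
  "full_subcategory C P = C\<lparr>Obj := {X \<in> Obj C. P X}\<rparr>"


section \<open>Weak higher dimensional transition systems\<close>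

text \<open>
  The set \<open>\<Sigma>\<close> of labels is the type \<open>'a\<close>.  The sets \<open>T\<^sub>n\<close> are recovered from \<open>transitions\<close> as its
  elements \<open>(\<alpha>, us, \<beta>)\<close> with \<open>length us = n\<close>.
\<close>

record ('s, 'l, 'a) whdts =
  states :: "'s set"
  actions :: "'l set"
  labelling :: "'l \<Rightarrow> 'a"
  transitions :: "('s \<times> 'l list \<times> 's) set"

definition multiset_axiom :: "('s \<times> 'l list \<times> 's) set \<Rightarrow> bool" where
  "multiset_axiom T \<longleftrightarrow>
     (\<forall>\<alpha> us \<beta> \<sigma>. (\<alpha>, us, \<beta>) \<in> T \<and> length us \<ge> 2 \<and> \<sigma> permutes {..<length us}
        \<longrightarrow> (\<alpha>, permute_list \<sigma> us, \<beta>) \<in> T)"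

definition coherence_axiom :: "('s \<times> 'l list \<times> 's) set \<Rightarrow> bool" where
  "coherence_axiom T \<longleftrightarrow>
     (\<forall>\<alpha> us \<beta> \<nu>1 \<nu>2 p q.
        length us \<ge> 3 \<and> p \<ge> 1 \<and> q \<ge> 1 \<and> p + q < length us \<and>
        (\<alpha>, us, \<beta>) \<in> T \<and>
        (\<alpha>, take p us, \<nu>1) \<in> T \<and> (\<nu>1, drop p us, \<beta>) \<in> T \<and>
        (\<alpha>, take (p + q) us, \<nu>2) \<in> T \<and> (\<nu>2, drop (p + q) us, \<beta>) \<in> T
        \<longrightarrow> (\<nu>1, take q (drop p us), \<nu>2) \<in> T)"

definition is_whdts :: "('s, 'l, 'a) whdts \<Rightarrow> bool" where
  "is_whdts X \<longleftrightarrow>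
     (\<forall>(\<alpha>, us, \<beta>) \<in> transitions X.
        \<alpha> \<in> states X \<and> \<beta> \<in> states X \<and> set us \<subseteq> actions X \<and> length us \<ge> 1) \<and>
     multiset_axiom (transitions X) \<and> coherence_axiom (transitions X)"

text \<open>
  Maps between carrier sets are taken extensional (\<open>undefined\<close> off the carrier),
  so that equality of arrows is equality of maps on the carriers.
\<close>

definition whdts_hom ::
    "('s, 'l, 'a) whdts \<Rightarrow> ('t, 'k, 'a) whdts \<Rightarrow> (('s \<Rightarrow> 't) \<times> ('l \<Rightarrow> 'k)) set" where
  "whdts_hom X Y = {(f, g).
     f \<in> states X \<rightarrow>\<^sub>E states Y \<and> g \<in> actions X \<rightarrow>\<^sub>E actions Y \<and>
     (\<forall>u\<in>actions X. labelling Y (g u) = labelling X u) \<and>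
     (\<forall>(\<alpha>, us, \<beta>) \<in> transitions X. (f \<alpha>, map g us, f \<beta>) \<in> transitions Y)}"

definition whdts_id :: "('s, 'l, 'a) whdts \<Rightarrow> ('s \<Rightarrow> 's) \<times> ('l \<Rightarrow> 'l)" where
  "whdts_id X = (\<lambda>s\<in>states X. s, \<lambda>u\<in>actions X. u)"

definition whdts_comp ::
    "('s, 'l, 'a) whdts \<Rightarrow> ('t \<Rightarrow> 'v) \<times> ('k \<Rightarrow> 'w) \<Rightarrow> ('s \<Rightarrow> 't) \<times> ('l \<Rightarrow> 'k)
       \<Rightarrow> ('s \<Rightarrow> 'v) \<times> ('l \<Rightarrow> 'w)" where
  "whdts_comp X g f = (compose (states X) (fst g) (fst f), compose (actions X) (snd g) (snd f))"

definition WHDTS ::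
    "(('s, 'l, 'a) whdts, ('s \<Rightarrow> 's) \<times> ('l \<Rightarrow> 'l)) category" where
  "WHDTS = \<lparr>Obj = {X. is_whdts X}, Hom = whdts_hom, Idn = whdts_id,
            Comp = (\<lambda>X Y Z. whdts_comp X)\<rparr>"


section \<open>The category of cubes\<close>

text \<open>
  \<open>[n] = {0,1}\<^sup>n\<close> consists of the bit lists of length \<open>n\<close>, with \<open>False\<close>, \<open>True\<close> for \<open>0\<close>, \<open>1\<close>;
  coordinates are numbered from \<open>0\<close>.
\<close>

definition cube :: "nat \<Rightarrow> bool list set" where
  "cube n = {e. length e = n}"

definition face :: "nat \<Rightarrow> nat \<Rightarrow> bool \<Rightarrow> bool list \<Rightarrow> bool list" where
  "face n i b = (\<lambda>e\<in>cube n. take i e @ b # drop i e)"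

definition symm :: "nat \<Rightarrow> nat \<Rightarrow> bool list \<Rightarrow> bool list" where
  "symm n i = (\<lambda>e\<in>cube n. e[i := e ! Suc i, Suc i := e ! i])"

inductive box_mor :: "nat \<Rightarrow> nat \<Rightarrow> (bool list \<Rightarrow> bool list) \<Rightarrow> bool" where
  ident: "box_mor n n (\<lambda>e\<in>cube n. e)"
| face: "i \<le> n \<Longrightarrow> box_mor n (Suc n) (face n i b)"
| symm: "Suc i < n \<Longrightarrow> box_mor n n (symm n i)"
| comp: "box_mor k m f \<Longrightarrow> box_mor m n g \<Longrightarrow> box_mor k n (compose (cube k) g f)"

abbreviation box :: "nat \<Rightarrow> nat \<Rightarrow> (bool list \<Rightarrow> bool list) set" where
  "box m n \<equiv> {f. box_mor m n f}"

datatype coord = MInf | PInf | Ix nat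

primrec coord_val :: "bool list \<Rightarrow> coord \<Rightarrow> bool" where
  "coord_val e MInf = False"
| "coord_val e PInf = True"
| "coord_val e (Ix i) = e ! i"

definition coords :: "nat \<Rightarrow> coord set" where
  "coords m = {MInf, PInf} \<union> Ix ` {..<m}"

text \<open>\<open>hat m f\<close> is the map \<open>\<widehat>f\<close> attached to \<open>f : [m] \<rightarrow> [n]\<close>, and \<open>hat_inv m n f i\<close> is the
  unique preimage of \<open>i\<close> under it.\<close>

definition hat :: "nat \<Rightarrow> (bool list \<Rightarrow> bool list) \<Rightarrow> nat \<Rightarrow> coord" where
  "hat m f j = (THE c. c \<in> coords m \<and> (\<forall>e\<in>cube m. f e ! j = coord_val e c))"

definition hat_inv :: "nat \<Rightarrow> nat \<Rightarrow> (bool list \<Rightarrow> bool list) \<Rightarrow> nat \<Rightarrow> nat" where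
  "hat_inv m n f i = (THE j. j < n \<and> hat m f j = Ix i)"


section \<open>Symmetric precubical sets\<close>

text \<open>For \<open>f : [m] \<rightarrow> [n]\<close>, the map \<open>pull K m n f : K\<^sub>n \<rightarrow> K\<^sub>m\<close> is \<open>K(f)\<close>.\<close>

record 'x sps =
  cubes :: "nat \<Rightarrow> 'x set"
  pull :: "nat \<Rightarrow> nat \<Rightarrow> (bool list \<Rightarrow> bool list) \<Rightarrow> 'x \<Rightarrow> 'x"

definition is_sps :: "('x, 'z) sps_scheme \<Rightarrow> bool" where
  "is_sps K \<longleftrightarrow>
     (\<forall>m n. \<forall>f\<in>box m n. \<forall>x\<in>cubes K n. pull K m n f x \<in> cubes K m) \<and>
     (\<forall>n. \<forall>x\<in>cubes K n. pull K n n (\<lambda>e\<in>cube n. e) x = x) \<and>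
     (\<forall>k m n. \<forall>f\<in>box k m. \<forall>g\<in>box m n. \<forall>x\<in>cubes K n.
        pull K k n (compose (cube k) g f) x = pull K k m f (pull K m n g x))"

definition sps_hom ::
    "('x, 'z) sps_scheme \<Rightarrow> ('y, 'w) sps_scheme \<Rightarrow> (nat \<Rightarrow> 'x \<Rightarrow> 'y) set" where
  "sps_hom K L = {\<phi>.
     (\<forall>n. \<phi> n \<in> cubes K n \<rightarrow>\<^sub>E cubes L n) \<and>
     (\<forall>m n. \<forall>f\<in>box m n. \<forall>x\<in>cubes K n. \<phi> m (pull K m n f x) = pull L m n f (\<phi> n x))}"

definition rep :: "nat \<Rightarrow> (bool list \<Rightarrow> bool list) sps" where
  "rep n = \<lparr>cubes = (\<lambda>k. box k n), pull = (\<lambda>k l f g. compose (cube k) g f)\<rparr>"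

definition boundary :: "nat \<Rightarrow> (bool list \<Rightarrow> bool list) sps" where
  "boundary n = (rep n)\<lparr>cubes := (\<lambda>k. if k < n then box k n else {})\<rparr>"

text \<open>
  The symmetric precubical set \<open>!\<^sup>S\<Sigma>\<close>.  The formula for a general \<open>f : [m] \<rightarrow> [n]\<close> is the one
  forced by the values on faces and symmetries, see \<open>words_face\<close>, \<open>words_symm\<close> and \<open>is_sps_words\<close>.
\<close>

definition words :: "'a list sps" where
  "words = \<lparr>cubes = (\<lambda>n. {w. length w = n}),
            pull = (\<lambda>m n f w. map (\<lambda>i. w ! hat_inv m n f i) [0..<m])\<rparr>"

record ('x, 'a) lsps = "'x sps" +
  lab :: "nat \<Rightarrow> 'x \<Rightarrow> 'a list"

definition is_lsps :: "('x, 'a) lsps \<Rightarrow> bool" where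
  "is_lsps K \<longleftrightarrow> is_sps K \<and> lab K \<in> sps_hom K words"

definition lsps_hom :: "('x, 'a) lsps \<Rightarrow> ('y, 'a) lsps \<Rightarrow> (nat \<Rightarrow> 'x \<Rightarrow> 'y) set" where
  "lsps_hom K L = {\<phi> \<in> sps_hom K L. \<forall>n. \<forall>x\<in>cubes K n. lab L n (\<phi> n x) = lab K n x}"

definition sps_id :: "('x, 'z) sps_scheme \<Rightarrow> nat \<Rightarrow> 'x \<Rightarrow> 'x" where
  "sps_id K = (\<lambda>n. \<lambda>x\<in>cubes K n. x)"

definition sps_comp ::
    "('x, 'z) sps_scheme \<Rightarrow> (nat \<Rightarrow> 'y \<Rightarrow> 'v) \<Rightarrow> (nat \<Rightarrow> 'x \<Rightarrow> 'y) \<Rightarrow> nat \<Rightarrow> 'x \<Rightarrow> 'v" where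
  "sps_comp K \<psi> \<phi> = (\<lambda>n. compose (cubes K n) (\<psi> n) (\<phi> n))"

definition LSPS :: "(('x, 'a) lsps, nat \<Rightarrow> 'x \<Rightarrow> 'x) category" where
  "LSPS = \<lparr>Obj = {K. is_lsps K}, Hom = lsps_hom, Idn = sps_id,
           Comp = (\<lambda>K L M. sps_comp K)\<rparr>"

definition labelled_cube :: "'a list \<Rightarrow> (bool list \<Rightarrow> bool list, 'a) lsps" where
  "labelled_cube a = \<lparr>cubes = cubes (rep (length a)), pull = pull (rep (length a)),
     lab = (\<lambda>k. \<lambda>f\<in>box k (length a). pull words k (length a) f a)\<rparr>"

definition hda_lifts ::
    "('x, 'a) lsps \<Rightarrow> nat \<Rightarrow> (nat \<Rightarrow> (bool list \<Rightarrow> bool list) \<Rightarrow> 'x)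
       \<Rightarrow> (nat \<Rightarrow> (bool list \<Rightarrow> bool list) \<Rightarrow> 'a list)
       \<Rightarrow> (nat \<Rightarrow> (bool list \<Rightarrow> bool list) \<Rightarrow> 'x) set" where
  "hda_lifts K p \<phi> \<psi> = {\<theta> \<in> sps_hom (rep p) K.
     sps_comp (boundary p) \<theta> (sps_id (boundary p)) = \<phi> \<and>
     sps_comp (rep p) (lab K) \<theta> = \<psi>}"

definition hda_paradigm :: "('x, 'a) lsps \<Rightarrow> bool" where
  "hda_paradigm K \<longleftrightarrow>
     (\<forall>p\<ge>2. \<forall>\<phi>\<in>sps_hom (boundary p) K. \<forall>\<psi>\<in>sps_hom (rep p) (words :: 'a list sps).
        sps_comp (boundary p) (lab K) \<phi> = sps_comp (boundary p) \<psi> (sps_id (boundary p))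
        \<longrightarrow> (\<forall>\<theta>\<in>hda_lifts K p \<phi> \<psi>. \<forall>\<theta>'\<in>hda_lifts K p \<phi> \<psi>. \<theta> = \<theta>'))"

definition HDA :: "(('x, 'a) lsps, nat \<Rightarrow> 'x \<Rightarrow> 'x) category" where
  "HDA = full_subcategory LSPS hda_paradigm"


section \<open>The cubes as weak higher dimensional transition systems\<close>

text \<open>The action \<open>(a\<^sub>i, i)\<close> is numbered from \<open>0\<close>.\<close>

definition Cn :: "'a list \<Rightarrow> (bool list, 'a \<times> nat, 'a) whdts" where
  "Cn a = \<lparr>states = cube (length a),
     actions = {(a ! i, i) | i. i < length a},
     labelling = fst,
     transitions = {(e, map (\<lambda>i. (a ! i, i)) is, e') | e is e'.
        e \<in> cube (length a) \<and> e' \<in> cube (length a) \<and>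
        length is \<ge> 1 \<and> distinct is \<and> set is \<subseteq> {..<length a} \<and>
        (\<forall>i<length a. e ! i \<le> e' ! i) \<and>
        (\<forall>i<length a. e ! i \<noteq> e' ! i \<longleftrightarrow> i \<in> set is)}\<rparr>"

text \<open>
  The value of the functor on the map of labelled cubes \<open>\<box>\<^sub>S[f\<^sup>*b] \<rightarrow> \<box>\<^sub>S[b]\<close> given by
  \<open>f : [m] \<rightarrow> [length b]\<close>; by the Yoneda lemma every map of labelled cubes is of this form.
\<close>

definition Cn_map ::
    "nat \<Rightarrow> (bool list \<Rightarrow> bool list) \<Rightarrow> 'a list
       \<Rightarrow> (bool list \<Rightarrow> bool list) \<times> ('a \<times> nat \<Rightarrow> 'a \<times> nat)" where
  "Cn_map m f b = (f,
     \<lambda>u\<in>actions (Cn (pull words m (length b) f b)).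
        (let j = hat_inv m (length b) f (snd u) in (b ! j, j)))"


section \<open>Colimits of weak higher dimensional transition systems\<close>

text \<open>
  A diagram has a set \<open>J\<close> of vertices, objects \<open>D j\<close>, and a set \<open>E\<close> of arrows \<open>(i, f, j)\<close>
  with \<open>f : D i \<rightarrow> D j\<close>.  Its colimit is computed on states and actions as for sets; the
  transitions are the smallest ones making it a weak higher dimensional transition system that
  receives all \<open>D j\<close>.
\<close>

definition glue :: "('j \<times> 'v) set \<Rightarrow> (('j \<times> 'v) \<times> ('j \<times> 'v)) set
    \<Rightarrow> (('j \<times> 'v) \<times> ('j \<times> 'v)) set" where
  "glue A R = (R \<union> converse R)\<^sup>* \<inter> A \<times> A"

inductive_set whdts_closure :: "('s \<times> 'l list \<times> 's) set \<Rightarrow> ('s \<times> 'l list \<times> 's) set"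
  for T where
  base: "t \<in> T \<Longrightarrow> t \<in> whdts_closure T"
| mult: "(\<alpha>, us, \<beta>) \<in> whdts_closure T \<Longrightarrow> length us \<ge> 2 \<Longrightarrow> \<sigma> permutes {..<length us}
    \<Longrightarrow> (\<alpha>, permute_list \<sigma> us, \<beta>) \<in> whdts_closure T"
| cohe: "length us \<ge> 3 \<Longrightarrow> p \<ge> 1 \<Longrightarrow> q \<ge> 1 \<Longrightarrow> p + q < length us
    \<Longrightarrow> (\<alpha>, us, \<beta>) \<in> whdts_closure T
    \<Longrightarrow> (\<alpha>, take p us, \<nu>1) \<in> whdts_closure T \<Longrightarrow> (\<nu>1, drop p us, \<beta>) \<in> whdts_closure T
    \<Longrightarrow> (\<alpha>, take (p + q) us, \<nu>2) \<in> whdts_closure T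
    \<Longrightarrow> (\<nu>2, drop (p + q) us, \<beta>) \<in> whdts_closure T
    \<Longrightarrow> (\<nu>1, take q (drop p us), \<nu>2) \<in> whdts_closure T"

definition glue_states ::
    "'j set \<Rightarrow> ('j \<times> (('s \<Rightarrow> 's) \<times> ('l \<Rightarrow> 'l)) \<times> 'j) set \<Rightarrow> ('j \<Rightarrow> ('s, 'l, 'a) whdts)
       \<Rightarrow> (('j \<times> 's) \<times> ('j \<times> 's)) set" where
  "glue_states J E D = glue (SIGMA j:J. states (D j))
     {((i, s), (j, fst f s)) | i f j s. (i, f, j) \<in> E \<and> s \<in> states (D i)}"

definition glue_actions ::
    "'j set \<Rightarrow> ('j \<times> (('s \<Rightarrow> 's) \<times> ('l \<Rightarrow> 'l)) \<times> 'j) set \<Rightarrow> ('j \<Rightarrow> ('s, 'l, 'a) whdts)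
       \<Rightarrow> (('j \<times> 'l) \<times> ('j \<times> 'l)) set" where
  "glue_actions J E D = glue (SIGMA j:J. actions (D j))
     {((i, u), (j, snd f u)) | i f j u. (i, f, j) \<in> E \<and> u \<in> actions (D i)}"

definition whdts_colim ::
    "'j set \<Rightarrow> ('j \<times> (('s \<Rightarrow> 's) \<times> ('l \<Rightarrow> 'l)) \<times> 'j) set \<Rightarrow> ('j \<Rightarrow> ('s, 'l, 'a) whdts)
       \<Rightarrow> (('j \<times> 's) set, ('j \<times> 'l) set, 'a) whdts" where
  "whdts_colim J E D = \<lparr>
     states = (SIGMA j:J. states (D j)) // glue_states J E D,
     actions = (SIGMA j:J. actions (D j)) // glue_actions J E D,
     labelling = (\<lambda>c. THE a. \<exists>(j, u) \<in> c. a = labelling (D j) u),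
     transitions = whdts_closure
       {(glue_states J E D `` {(j, \<alpha>)}, map (\<lambda>u. glue_actions J E D `` {(j, u)}) us,
         glue_states J E D `` {(j, \<beta>)}) | j \<alpha> us \<beta>. j \<in> J \<and> (\<alpha>, us, \<beta>) \<in> transitions (D j)}\<rparr>"

definition whdts_coproj ::
    "'j set \<Rightarrow> ('j \<times> (('s \<Rightarrow> 's) \<times> ('l \<Rightarrow> 'l)) \<times> 'j) set \<Rightarrow> ('j \<Rightarrow> ('s, 'l, 'a) whdts) \<Rightarrow> 'j
       \<Rightarrow> ('s \<Rightarrow> ('j \<times> 's) set) \<times> ('l \<Rightarrow> ('j \<times> 'l) set)" where
  "whdts_coproj J E D j =
     (\<lambda>s\<in>states (D j). glue_states J E D `` {(j, s)},
      \<lambda>u\<in>actions (D j). glue_actions J E D `` {(j, u)})"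


section \<open>The functor from labelled symmetric precubical sets\<close>

text \<open>
  Every \<open>K\<close> is the colimit of the labelled cubes \<open>\<box>\<^sub>S[lab x]\<close> indexed by its category of elements,
  so the colimit-preserving functor is the colimit of the \<open>C\<^sub>n[lab x]\<close> over that category.
  That this is the required functor is shown by \<open>is_functor_TT\<close>, \<open>cube_iso\<close>,
  \<open>cube_iso_natural\<close> and, for the preservation of colimits, \<open>adjunction\<close> and
  \<open>adjunction_natural\<close>.
\<close>

definition elements :: "('x, 'a) lsps \<Rightarrow> (nat \<times> 'x) set" where
  "elements K = {(n, x). x \<in> cubes K n}"

definition element_arrows :: "('x, 'a) lsps \<Rightarrow>
    ((nat \<times> 'x) \<times> ((bool list \<Rightarrow> bool list) \<times> ('a \<times> nat \<Rightarrow> 'a \<times> nat)) \<times> (nat \<times> 'x)) set" where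
  "element_arrows K =
     {((m, pull K m n f x), Cn_map m f (lab K n x), (n, x)) | m n f x. f \<in> box m n \<and> x \<in> cubes K n}"

definition element_cube :: "('x, 'a) lsps \<Rightarrow> nat \<times> 'x \<Rightarrow> (bool list, 'a \<times> nat, 'a) whdts" where
  "element_cube K = (\<lambda>(n, x). Cn (lab K n x))"

definition T_obj :: "('x, 'a) lsps
    \<Rightarrow> (((nat \<times> 'x) \<times> bool list) set, ((nat \<times> 'x) \<times> ('a \<times> nat)) set, 'a) whdts" where
  "T_obj K = whdts_colim (elements K) (element_arrows K) (element_cube K)"

definition T_coproj :: "('x, 'a) lsps \<Rightarrow> nat \<Rightarrow> 'x
    \<Rightarrow> (bool list \<Rightarrow> ((nat \<times> 'x) \<times> bool list) set)
        \<times> ('a \<times> nat \<Rightarrow> ((nat \<times> 'x) \<times> ('a \<times> nat)) set)" where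
  "T_coproj K n x = whdts_coproj (elements K) (element_arrows K) (element_cube K) (n, x)"

definition relabel :: "(nat \<Rightarrow> 'x \<Rightarrow> 'y) \<Rightarrow> (nat \<times> 'x) \<times> 'v \<Rightarrow> (nat \<times> 'y) \<times> 'v" where
  "relabel \<phi> = (\<lambda>((n, x), v). ((n, \<phi> n x), v))"

text \<open>
  \<open>T(\<phi>)\<close> sends the class of \<open>((n, x), v)\<close> to the class of \<open>((n, \<phi> n x), v)\<close>, see \<open>T_mor_coproj\<close>.
\<close>

definition T_mor :: "('x, 'a) lsps \<Rightarrow> ('y, 'a) lsps \<Rightarrow> (nat \<Rightarrow> 'x \<Rightarrow> 'y)
    \<Rightarrow> (((nat \<times> 'x) \<times> bool list) set \<Rightarrow> ((nat \<times> 'y) \<times> bool list) set)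
        \<times> (((nat \<times> 'x) \<times> ('a \<times> nat)) set \<Rightarrow> ((nat \<times> 'y) \<times> ('a \<times> nat)) set)" where
  "T_mor K L \<phi> =
     (\<lambda>c\<in>states (T_obj K).
        glue_states (elements L) (element_arrows L) (element_cube L) `` (relabel \<phi> ` c),
      \<lambda>c\<in>actions (T_obj K).
        glue_actions (elements L) (element_arrows L) (element_cube L) `` (relabel \<phi> ` c))"

definition TT where
  "TT = \<lparr>on_obj = T_obj, on_hom = T_mor\<rparr>"


section \<open>Coordinates of the maps between cubes\<close>

lemma box_mor_map: "box_mor m n f \<Longrightarrow> f \<in> cube m \<rightarrow>\<^sub>E cube n"
proof (induction rule: box_mor.induct)
  case (comp k m f n g)
  then show ?case by (auto simp: compose_def PiE_def extensional_def Pi_def)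
qed (auto simp: cube_def face_def symm_def split: if_splits)

lemma box_mor_cube: "box_mor m n f \<Longrightarrow> e \<in> cube m \<Longrightarrow> f e \<in> cube n"
  using box_mor_map by blast

lemma coord_unique:
  assumes "c \<in> coords m" "d \<in> coords m" "\<And>e. e \<in> cube m \<Longrightarrow> coord_val e c = coord_val e d"
  shows "c = d"
proof -
  have r: "replicate m b \<in> cube m" for b by (simp add: cube_def)
  have u: "(replicate m False)[i := True] \<in> cube m" for i by (simp add: cube_def)
  show ?thesis
  proof (cases c; cases d)
    fix i j assume "c = Ix i" "d = Ix j"
    then show ?thesis using assms(1,2) assms(3)[OF u[of i]] by (auto simp: coords_def nth_list_update split: if_splits)
  qed (use assms(1,2) assms(3)[OF r[of True]] assms(3)[OF r[of False]] in \<open>auto simp: coords_def\<close>)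
qed

lemma box_mor_coords:
  "box_mor m n f \<Longrightarrow> \<exists>h. (\<forall>j<n. h j \<in> coords m) \<and>
     (\<forall>j<n. \<forall>e\<in>cube m. f e ! j = coord_val e (h j)) \<and> (\<forall>i<m. \<exists>!j. j < n \<and> h j = Ix i)"
proof (induction rule: box_mor.induct)
  case (ident n)
  show ?case by (rule exI[of _ Ix]) (auto simp: coords_def)
next
  case (face i n b)
  let ?h = "\<lambda>j. if j < i then Ix j else if j = i then (if b then PInf else MInf) else Ix (j - 1)"
  have "\<exists>!j. j < Suc n \<and> ?h j = Ix l" if "l < n" for l
    by (rule ex1I[of _ "if l < i then l else Suc l"]) (use that in \<open>auto split: if_splits\<close>)
  moreover have "\<forall>j<Suc n. ?h j \<in> coords n" using face by (auto simp: coords_def)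
  moreover have "\<forall>j<Suc n. \<forall>e\<in>cube n. face n i b e ! j = coord_val e (?h j)"
    using face by (auto simp: face_def cube_def nth_append nth_Cons')
  ultimately show ?case by (intro exI[of _ ?h]) blast
next
  case (symm i n)
  let ?h = "\<lambda>j. Ix (if j = i then Suc i else if j = Suc i then i else j)"
  have "\<exists>!j. j < n \<and> ?h j = Ix l" if "l < n" for l
    by (rule ex1I[of _ "if l = i then Suc i else if l = Suc i then i else l"])
       (use that symm in \<open>auto split: if_splits\<close>)
  moreover have "\<forall>j<n. ?h j \<in> coords n" using symm by (auto simp: coords_def)
  moreover have "\<forall>j<n. \<forall>e\<in>cube n. symm n i e ! j = coord_val e (?h j)"
    using symm by (auto simp: symm_def cube_def nth_list_update)
  ultimately show ?case by (intro exI[of _ ?h]) blast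
next
  case (comp k m f n g)
  from comp.IH(1) obtain h1 where 1: "\<forall>j<m. h1 j \<in> coords k"
    "\<forall>j<m. \<forall>e\<in>cube k. f e ! j = coord_val e (h1 j)" "\<forall>i<k. \<exists>!j. j < m \<and> h1 j = Ix i" by blast
  from comp.IH(2) obtain h2 where 2: "\<forall>j<n. h2 j \<in> coords m"
    "\<forall>j<n. \<forall>e\<in>cube m. g e ! j = coord_val e (h2 j)" "\<forall>i<m. \<exists>!j. j < n \<and> h2 j = Ix i" by blast
  let ?h = "\<lambda>j. case h2 j of MInf \<Rightarrow> MInf | PInf \<Rightarrow> PInf | Ix l \<Rightarrow> h1 l"
  have a: "\<forall>j<n. ?h j \<in> coords k"
  proof (intro allI impI)
    fix j assume "j < n"
    then have "h2 j \<in> coords m" using 2(1) by blast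
    then show "?h j \<in> coords k" using 1(1) by (cases "h2 j") (auto simp: coords_def)
  qed
  have b: "\<forall>j<n. \<forall>e\<in>cube k. compose (cube k) g f e ! j = coord_val e (?h j)"
  proof (intro allI impI ballI)
    fix j e assume j: "j < n" "e \<in> cube k"
    then have "compose (cube k) g f e ! j = coord_val (f e) (h2 j)"
      using 2(2) comp.hyps(1) by (simp add: compose_def box_mor_cube)
    also have "\<dots> = coord_val e (?h j)"
    proof (cases "h2 j")
      case (Ix l)
      then have "l < m" using 2(1) j by (force simp: coords_def)
      then show ?thesis using Ix 1(2) j by simp
    qed auto
    finally show "compose (cube k) g f e ! j = coord_val e (?h j)" .
  qed
  have "\<exists>!j. j < n \<and> ?h j = Ix i" if i: "i < k" for i
  proof -
    obtain l where l': "l < m \<and> h1 l = Ix i" "\<forall>l'. l' < m \<and> h1 l' = Ix i \<longrightarrow> l' = l"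
      using 1(3)[rule_format, OF i] by (rule ex1E)
    note l = conjunct1[OF l'(1)] conjunct2[OF l'(1)] l'(2)[rule_format, OF conjI]
    obtain j where j': "j < n \<and> h2 j = Ix l" "\<forall>j'. j' < n \<and> h2 j' = Ix l \<longrightarrow> j' = j"
      using 2(3)[rule_format, OF l(1)] by (rule ex1E)
    note j = conjunct1[OF j'(1)] conjunct2[OF j'(1)] j'(2)[rule_format, OF conjI]
    have ex: "j < n \<and> ?h j = Ix i" using j(1,2) l(2) by simp
    have "j' = j" if "j' < n" "?h j' = Ix i" for j'
    proof (cases "h2 j'")
      case (Ix l')
      then have "Ix l' \<in> coords m" using 2(1) that(1) by metis
      then have "l' < m" by (auto simp: coords_def)
      moreover have "h1 l' = Ix i" using that(2) Ix by simp
      ultimately have "l' = l" by (rule l(3))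
      then show ?thesis using j(3)[OF that(1)] Ix by simp
    qed (use that in auto)
    with ex show ?thesis by (intro ex1I[of _ j]) auto
  qed
  with a b show ?case by (intro exI[of _ ?h]) blast
qed

lemma hat_eqI:
  assumes "c \<in> coords m" "\<And>e. e \<in> cube m \<Longrightarrow> f e ! j = coord_val e c"
  shows "hat m f j = c"
  unfolding hat_def using assms by (intro the_equality) (auto intro!: coord_unique)

lemma hat_properties:
  assumes "box_mor m n f"
  shows "j < n \<Longrightarrow> hat m f j \<in> coords m"
    and "j < n \<Longrightarrow> e \<in> cube m \<Longrightarrow> f e ! j = coord_val e (hat m f j)"
    and "i < m \<Longrightarrow> \<exists>!j. j < n \<and> hat m f j = Ix i"
proof -
  obtain h where h: "\<forall>j<n. h j \<in> coords m"
     "\<forall>j<n. \<forall>e\<in>cube m. f e ! j = coord_val e (h j)" "\<forall>i<m. \<exists>!j. j < n \<and> h j = Ix i"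
    using box_mor_coords[OF assms] by blast
  have eq: "hat m f j = h j" if "j < n" for j using h(1,2) that by (intro hat_eqI) auto
  show "j < n \<Longrightarrow> hat m f j \<in> coords m"
    and "j < n \<Longrightarrow> e \<in> cube m \<Longrightarrow> f e ! j = coord_val e (hat m f j)" using h eq by auto
  assume "i < m"
  then show "\<exists>!j. j < n \<and> hat m f j = Ix i" using h(3) eq by metis
qed

lemma hat_inv_properties:
  assumes "box_mor m n f" "i < m"
  shows "hat_inv m n f i < n" "hat m f (hat_inv m n f i) = Ix i"
  using theI'[OF hat_properties(3)[OF assms]] by (auto simp: hat_inv_def)

lemma hat_inv_eqI:
  assumes "box_mor m n f" "i < m" "j < n" "\<And>e. e \<in> cube m \<Longrightarrow> f e ! j = e ! i"
  shows "hat_inv m n f i = j"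
proof -
  have "hat m f j = Ix i" using assms by (intro hat_eqI) (auto simp: coords_def)
  then show ?thesis using hat_properties(3)[OF assms(1,2)] hat_inv_properties[OF assms(1,2)] assms(3)
    by blast
qed

lemma hat_inv_nth:
  assumes "box_mor m n f" "i < m" "e \<in> cube m"
  shows "f e ! hat_inv m n f i = e ! i"
  using hat_properties(2)[OF assms(1) hat_inv_properties(1)[OF assms(1,2)] assms(3)]
    hat_inv_properties(2)[OF assms(1,2)] by simp

lemma hat_inv_inj:
  assumes "box_mor m n f" "i < m" "j < m" "hat_inv m n f i = hat_inv m n f j"
  shows "i = j"
  by (metis assms hat_inv_properties(2) coord.inject)

lemma hat_inv_ident: "i < n \<Longrightarrow> hat_inv n n (\<lambda>e\<in>cube n. e) i = i"
  by (rule hat_inv_eqI) (auto intro: box_mor.ident)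

lemma hat_inv_comp:
  assumes f: "box_mor k m f" and g: "box_mor m n g" and i: "i < k"
  shows "hat_inv k n (compose (cube k) g f) i = hat_inv m n g (hat_inv k m f i)"
proof (rule hat_inv_eqI[OF box_mor.comp[OF f g] i])
  note l = hat_inv_properties(1)[OF f i]
  show "hat_inv m n g (hat_inv k m f i) < n" by (rule hat_inv_properties(1)[OF g l])
  fix e assume e: "e \<in> cube k"
  show "compose (cube k) g f e ! hat_inv m n g (hat_inv k m f i) = e ! i"
    using hat_inv_nth[OF g l box_mor_cube[OF f e]] hat_inv_nth[OF f i e] e by (simp add: compose_def)
qed

lemma words_face:
  assumes "i \<le> n" "length w = Suc n"
  shows "pull words n (Suc n) (face n i b) w = take i w @ drop (Suc i) w"
proof (rule nth_equalityI)
  fix l assume "l < length (pull words n (Suc n) (face n i b) w)"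
  then have l: "l < n" by (simp add: words_def)
  have "hat_inv n (Suc n) (face n i b) l = (if l < i then l else Suc l)"
    using l assms(1)
    by (intro hat_inv_eqI box_mor.face) (auto simp: face_def cube_def nth_append nth_Cons')
  then show "pull words n (Suc n) (face n i b) w ! l = (take i w @ drop (Suc i) w) ! l"
    using l assms by (auto simp: words_def nth_append)
qed (use assms in \<open>auto simp: words_def\<close>)

lemma words_symm:
  assumes "Suc i < n" "length w = n"
  shows "pull words n n (symm n i) w = w[i := w ! Suc i, Suc i := w ! i]"
proof (rule nth_equalityI)
  fix l assume "l < length (pull words n n (symm n i) w)"
  then have l: "l < n" by (simp add: words_def)
  have "hat_inv n n (symm n i) l = (if l = i then Suc i else if l = Suc i then i else l)"
    using l assms(1)
    by (intro hat_inv_eqI box_mor.symm) (auto simp: symm_def cube_def nth_list_update)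
  then show "pull words n n (symm n i) w ! l = w[i := w ! Suc i, Suc i := w ! i] ! l"
    using l assms by (auto simp: words_def nth_list_update)
qed (use assms in \<open>auto simp: words_def\<close>)

lemma is_sps_words: "is_sps words"
  by (auto simp: is_sps_def words_def hat_inv_ident hat_inv_comp hat_inv_properties(1) intro!: nth_equalityI)

lemma compose_ident_right: "f \<in> extensional A \<Longrightarrow> compose A f (\<lambda>x\<in>A. x) = f"
  by (auto simp: compose_def extensional_def fun_eq_iff)

lemma compose_ident_left: "f \<in> A \<rightarrow>\<^sub>E B \<Longrightarrow> compose A (\<lambda>x\<in>B. x) f = f"
  by (auto simp: compose_def PiE_def extensional_def fun_eq_iff)

lemma compose_assoc_ext:
  "f \<in> A \<rightarrow> B \<Longrightarrow> compose A (compose B h g) f = compose A h (compose A g f)"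
  by (auto simp: compose_def fun_eq_iff)

lemma is_sps_rep: "is_sps (rep n)"
proof -
  have "compose (cube k) x (compose (cube k) g f) = compose (cube k) (compose (cube m) x g) f"
    if "box_mor k m f" for k m f g and x :: "bool list \<Rightarrow> bool list"
    using box_mor_map[OF that] by (intro compose_assoc_ext[symmetric]) auto
  moreover have "compose (cube k) x (\<lambda>e\<in>cube k. e) = x" if "box_mor k n x" for k x
    using box_mor_map[OF that] by (intro compose_ident_right) (auto simp: PiE_def)
  ultimately show ?thesis by (auto simp: is_sps_def rep_def intro: box_mor.comp)
qed

lemma box_mor_le: "box_mor m n f \<Longrightarrow> m \<le> n"
  by (induction rule: box_mor.induct) auto

lemma is_sps_boundary: "is_sps (boundary n)"
  using is_sps_rep[of n] by (auto simp: is_sps_def rep_def boundary_def dest: box_mor_le split: if_splits)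

lemma is_lsps_labelled_cube: "is_lsps (labelled_cube a)"
proof -
  have "is_sps (labelled_cube a)" using is_sps_rep[of "length a"]
    by (simp add: is_sps_def labelled_cube_def)
  moreover have "lab (labelled_cube a) \<in> sps_hom (labelled_cube a) words"
    using is_sps_words[where 'a='a] 
    by (auto simp: labelled_cube_def sps_hom_def is_sps_def rep_def words_def box_mor.comp)
  ultimately show ?thesis by (simp add: is_lsps_def)
qed


section \<open>The two categories are categories\<close>

lemma whdts_homD:
  assumes "(f, g) \<in> whdts_hom X Y"
  shows "f \<in> states X \<rightarrow>\<^sub>E states Y" "g \<in> actions X \<rightarrow>\<^sub>E actions Y"
    "u \<in> actions X \<Longrightarrow> labelling Y (g u) = labelling X u"
    "(\<alpha>, us, \<beta>) \<in> transitions X \<Longrightarrow> (f \<alpha>, map g us, f \<beta>) \<in> transitions Y"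
    "s \<in> states X \<Longrightarrow> f s \<in> states Y" "u \<in> actions X \<Longrightarrow> g u \<in> actions Y"
  using assms by (auto simp: whdts_hom_def)

lemma whdts_homI:
  assumes "f \<in> states X \<rightarrow>\<^sub>E states Y" "g \<in> actions X \<rightarrow>\<^sub>E actions Y"
    "\<And>u. u \<in> actions X \<Longrightarrow> labelling Y (g u) = labelling X u"
    "\<And>\<alpha> us \<beta>. (\<alpha>, us, \<beta>) \<in> transitions X \<Longrightarrow> (f \<alpha>, map g us, f \<beta>) \<in> transitions Y"
  shows "(f, g) \<in> whdts_hom X Y"
  using assms by (auto simp: whdts_hom_def)

lemma is_whdtsD:
  assumes "is_whdts X" "(\<alpha>, us, \<beta>) \<in> transitions X"
  shows "\<alpha> \<in> states X" "\<beta> \<in> states X" "set us \<subseteq> actions X" "length us \<ge> 1"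
  using assms by (auto simp: is_whdts_def)

lemma whdts_comp_hom:
  assumes "is_whdts X" "f \<in> whdts_hom X Y" "g \<in> whdts_hom Y Z"
  shows "whdts_comp X g f \<in> whdts_hom X Z"
proof -
  obtain f0 f1 where f: "f = (f0, f1)" by fastforce
  obtain g0 g1 where g: "g = (g0, g1)" by fastforce
  note F = whdts_homD[OF assms(2)[unfolded f]] and G = whdts_homD[OF assms(3)[unfolded g]]
  have "(compose (states X) g0 f0 \<alpha>, map (compose (actions X) g1 f1) us, compose (states X) g0 f0 \<beta>)
      \<in> transitions Z" if t: "(\<alpha>, us, \<beta>) \<in> transitions X" for \<alpha> us \<beta>
  proof -
    note D = is_whdtsD[OF assms(1) t]
    have "map (compose (actions X) g1 f1) us = map g1 (map f1 us)"
      using D(3) by (auto simp: compose_def)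
    moreover have "compose (states X) g0 f0 \<alpha> = g0 (f0 \<alpha>)" "compose (states X) g0 f0 \<beta> = g0 (f0 \<beta>)"
      using D(1,2) by (simp_all add: compose_def)
    ultimately show ?thesis using G(4)[OF F(4)[OF t]] by (simp only:)
  qed
  then show ?thesis unfolding f g whdts_comp_def fst_conv snd_conv
    by (intro whdts_homI) (use F G in \<open>auto simp: compose_def\<close>)
qed

lemma whdts_id_hom: "is_whdts X \<Longrightarrow> whdts_id X \<in> whdts_hom X X"
proof -
  assume X: "is_whdts X"
  have "map (\<lambda>u\<in>actions X. u) us = us" if "(\<alpha>, us, \<beta>) \<in> transitions X" for \<alpha> us \<beta>
    using is_whdtsD(3)[OF X that] by (intro map_idI) auto
  then show ?thesis using is_whdtsD(1,2)[OF X] unfolding whdts_id_def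
    by (intro whdts_homI) auto
qed

lemma whdts_comp_id:
  assumes "f \<in> whdts_hom X Y"
  shows "whdts_comp X f (whdts_id X) = f" "whdts_comp X (whdts_id Y) f = f"
  using assms by (auto simp: whdts_comp_def whdts_id_def whdts_hom_def compose_def fun_eq_iff
      PiE_def extensional_def)

lemma whdts_comp_assoc:
  assumes "f \<in> whdts_hom W X"
  shows "whdts_comp W (whdts_comp X h g) f = whdts_comp W h (whdts_comp W g f)"
  using assms by (auto simp: whdts_comp_def whdts_hom_def PiE_def intro!: compose_assoc_ext)

lemma is_category_WHDTS: "is_category WHDTS"
  by (simp add: is_category_def WHDTS_def whdts_id_hom whdts_comp_hom whdts_comp_id whdts_comp_assoc)

lemma sps_homD:
  assumes "\<phi> \<in> sps_hom K L"
  shows "\<phi> n \<in> cubes K n \<rightarrow>\<^sub>E cubes L n" "x \<in> cubes K n \<Longrightarrow> \<phi> n x \<in> cubes L n"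
    "box_mor m n f \<Longrightarrow> x \<in> cubes K n \<Longrightarrow> \<phi> m (pull K m n f x) = pull L m n f (\<phi> n x)"
  using assms by (auto simp: sps_hom_def)

lemma is_spsD:
  assumes "is_sps K"
  shows "box_mor m n f \<Longrightarrow> x \<in> cubes K n \<Longrightarrow> pull K m n f x \<in> cubes K m"
    "x \<in> cubes K n \<Longrightarrow> pull K n n (\<lambda>e\<in>cube n. e) x = x"
    "box_mor k m f \<Longrightarrow> box_mor m n g \<Longrightarrow> x \<in> cubes K n
      \<Longrightarrow> pull K k n (compose (cube k) g f) x = pull K k m f (pull K m n g x)"
  using assms by (auto simp: is_sps_def)

lemma sps_comp_hom:
  assumes "is_sps K" "\<phi> \<in> sps_hom K L" "\<psi> \<in> sps_hom L M"
  shows "sps_comp K \<psi> \<phi> \<in> sps_hom K M"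
  using sps_homD[OF assms(2)] sps_homD[OF assms(3)] is_spsD(1)[OF assms(1)]
  by (auto simp: sps_comp_def sps_hom_def compose_def)

lemma sps_id_hom: "is_sps K \<Longrightarrow> sps_id K \<in> sps_hom K K"
  by (auto simp: sps_id_def sps_hom_def is_spsD(1))

lemma lsps_comp_hom:
  assumes "is_lsps K" "\<phi> \<in> lsps_hom K L" "\<psi> \<in> lsps_hom L M"
  shows "sps_comp K \<psi> \<phi> \<in> lsps_hom K M"
proof -
  have "\<phi> \<in> sps_hom K L" "\<psi> \<in> sps_hom L M" "is_sps K"
    using assms by (auto simp: lsps_hom_def is_lsps_def)
  from sps_comp_hom[OF this(3,1,2)] sps_homD(2)[OF this(1)] show ?thesis using assms(2,3)
    by (auto simp: lsps_hom_def sps_comp_def compose_def)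
qed

lemma sps_comp_id:
  assumes "\<phi> \<in> sps_hom K L"
  shows "sps_comp K \<phi> (sps_id K) = \<phi>" "sps_comp K (sps_id L) \<phi> = \<phi>"
  using sps_homD(1)[OF assms]
  by (auto simp: sps_comp_def sps_id_def fun_eq_iff PiE_def compose_def extensional_def)

lemma sps_comp_assoc:
  assumes "\<phi> \<in> sps_hom K L"
  shows "sps_comp K (sps_comp L \<theta> \<psi>) \<phi> = sps_comp K \<theta> (sps_comp K \<psi> \<phi>)"
  using sps_homD(2)[OF assms] by (auto simp: sps_comp_def fun_eq_iff compose_def)

lemma lsps_hom_sps: "\<phi> \<in> lsps_hom K L \<Longrightarrow> \<phi> \<in> sps_hom K L"
  by (simp add: lsps_hom_def)

lemma lsps_id_hom: "is_lsps K \<Longrightarrow> sps_id K \<in> lsps_hom K K"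
  using sps_id_hom[of K] by (auto simp: is_lsps_def lsps_hom_def sps_id_def)

lemma is_category_LSPS: "is_category LSPS"
  by (simp add: is_category_def LSPS_def lsps_id_hom lsps_comp_hom
      sps_comp_id[OF lsps_hom_sps] sps_comp_assoc[OF lsps_hom_sps])

lemma is_category_full_subcategory: "is_category C \<Longrightarrow> is_category (full_subcategory C P)"
  by (auto simp: is_category_def full_subcategory_def)

lemma is_category_HDA: "is_category HDA"
  unfolding HDA_def by (intro is_category_full_subcategory is_category_LSPS)


section \<open>Universal property of the colimits\<close>

lemma glue_equiv: "equiv A (glue A R)"
proof (rule equivI)
  have s: "sym (R \<union> converse R)" by (auto simp: sym_def)
  show "sym (glue A R)" using sym_rtrancl[OF s] by (auto simp: glue_def sym_def)
  show "trans (glue A R)" unfolding glue_def by (auto simp: trans_def)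
qed (auto simp: glue_def refl_on_def)

lemma glue_respects:
  assumes "(a, b) \<in> glue A R" "\<And>a b. (a, b) \<in> R \<Longrightarrow> h a = h b"
  shows "h a = h b"
proof -
  have "(a, b) \<in> (R \<union> converse R)\<^sup>*" using assms(1) by (simp add: glue_def)
  then show ?thesis by (induction rule: rtrancl_induct) (use assms(2) in fastforce)+
qed

lemma glue_base: "(a, b) \<in> R \<Longrightarrow> a \<in> A \<Longrightarrow> b \<in> A \<Longrightarrow> glue A R `` {a} = glue A R `` {b}"
  by (intro equiv_class_eq[OF glue_equiv]) (auto simp: glue_def)

lemma glue_self: "a \<in> A \<Longrightarrow> a \<in> glue A R `` {a}"
  by (auto simp: glue_def)

lemma glue_mono_image:
  assumes h: "\<And>a. a \<in> A \<Longrightarrow> h a \<in> B"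
    and R: "\<And>a b. (a, b) \<in> R \<Longrightarrow> (h a, h b) \<in> S"
    and a: "a \<in> A"
  shows "glue B S `` (h ` (glue A R `` {a})) = glue B S `` {h a}"
proof -
  have "(h x, h y) \<in> (S \<union> converse S)\<^sup>*" if "(x, y) \<in> (R \<union> converse R)\<^sup>*" for x y
    using that by (induction rule: rtrancl_induct)
      (use R in \<open>auto intro: rtrancl.rtrancl_into_rtrancl\<close>)
  then have "(h x, h y) \<in> glue B S" if "(x, y) \<in> glue A R" for x y
    using that h by (auto simp: glue_def)
  then have "glue B S `` {h b} = glue B S `` {h a}" if "(a, b) \<in> glue A R" for b
    using that equiv_class_eq[OF glue_equiv] by metis
  then show ?thesis using glue_self[OF a, of R] by blast
qed

lemma glue_lift:
  assumes "\<And>a b. (a, b) \<in> R \<Longrightarrow> h a = h b" "a \<in> A"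
  shows "the_elem (h ` (glue A R `` {a})) = h a"
proof -
  have "h b = h a" if "b \<in> glue A R `` {a}" for b
    using glue_respects[of a b A R h] assms(1) that by simp
  then have "h ` (glue A R `` {a}) = {h a}" using glue_self[OF assms(2), of R] by blast
  then show ?thesis by simp
qed

lemma whdts_closure_axioms:
  "multiset_axiom (whdts_closure T)" "coherence_axiom (whdts_closure T)"
  unfolding multiset_axiom_def coherence_axiom_def
  by (intro allI impI, elim conjE, rule whdts_closure.mult, assumption+)
     (intro allI impI, elim conjE, rule whdts_closure.cohe, assumption+)

lemma whdts_closure_least:
  assumes "multiset_axiom U" "coherence_axiom U" "T \<subseteq> U"
  shows "whdts_closure T \<subseteq> U"
proof
  fix t assume "t \<in> whdts_closure T"
  then show "t \<in> U"
  proof (induction rule: whdts_closure.induct)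
    case (base t) then show ?case using assms(3) by blast
  next
    case (mult \<alpha> us \<beta> \<sigma>) then show ?case using assms(1) unfolding multiset_axiom_def by blast
  next
    case (cohe us p q \<alpha> \<beta> \<nu>1 \<nu>2)
    then show ?case using assms(2) unfolding coherence_axiom_def by blast
  qed
qed

lemma multiset_axiom_vimage:
  assumes "multiset_axiom U"
  shows "multiset_axiom {(\<alpha>, us, \<beta>). \<alpha> \<in> S \<and> \<beta> \<in> S \<and> set us \<subseteq> A \<and> length us \<ge> 1 \<and> (f \<alpha>, map g us, f \<beta>) \<in> U}"
  unfolding multiset_axiom_def
proof (clarify, intro conjI)
  fix \<alpha> us \<beta> \<sigma>
  assume a: "\<sigma> permutes {..<length us}" "length us \<ge> 2" "(f \<alpha>, map g us, f \<beta>) \<in> U"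
    "set us \<subseteq> A"
  show "set (permute_list \<sigma> us) \<subseteq> A" using a by (simp add: set_permute_list)
  show "(f \<alpha>, map g (permute_list \<sigma> us), f \<beta>) \<in> U"
    using assms a unfolding multiset_axiom_def permute_list_map[OF a(1), symmetric] by auto
qed auto

lemma coherence_axiom_vimage:
  assumes "coherence_axiom U"
  shows "coherence_axiom {(\<alpha>, us, \<beta>). \<alpha> \<in> S \<and> \<beta> \<in> S \<and> set us \<subseteq> A \<and> length us \<ge> 1 \<and> (f \<alpha>, map g us, f \<beta>) \<in> U}"
  unfolding coherence_axiom_def
proof (clarify, intro conjI)
  fix \<alpha> us \<beta> \<nu>1 \<nu>2 and p q :: nat
  assume a: "length us \<ge> 3" "p \<ge> 1" "q \<ge> 1" "p + q < length us"
    "(f \<alpha>, map g us, f \<beta>) \<in> U" "(f \<alpha>, map g (take p us), f \<nu>1) \<in> U"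
    "(f \<nu>1, map g (drop p us), f \<beta>) \<in> U" "(f \<alpha>, map g (take (p + q) us), f \<nu>2) \<in> U"
    "(f \<nu>2, map g (drop (p + q) us), f \<beta>) \<in> U" "set us \<subseteq> A"
  show "set (take q (drop p us)) \<subseteq> A" using a(10)
    by (meson order.trans set_drop_subset set_take_subset)
  show "length (take q (drop p us)) \<ge> 1" using a by simp
  show "(f \<nu>1, map g (take q (drop p us)), f \<nu>2) \<in> U"
    using assms[unfolded coherence_axiom_def, rule_format, of "map g us" p q "f \<alpha>" "f \<beta>" "f \<nu>1" "f \<nu>2"] a
    by (simp add: take_map drop_map)
qed

definition is_diagram ::
    "'j set \<Rightarrow> ('j \<times> (('s \<Rightarrow> 's) \<times> ('l \<Rightarrow> 'l)) \<times> 'j) set \<Rightarrow> ('j \<Rightarrow> ('s, 'l, 'a) whdts) \<Rightarrow> bool" where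
  "is_diagram J E D \<longleftrightarrow> (\<forall>j\<in>J. is_whdts (D j)) \<and>
     (\<forall>(i, f, j)\<in>E. i \<in> J \<and> j \<in> J \<and> f \<in> whdts_hom (D i) (D j))"

definition is_cocone ::
    "'j set \<Rightarrow> ('j \<times> (('s \<Rightarrow> 's) \<times> ('l \<Rightarrow> 'l)) \<times> 'j) set \<Rightarrow> ('j \<Rightarrow> ('s, 'l, 'a) whdts)
       \<Rightarrow> ('t, 'k, 'a) whdts \<Rightarrow> ('j \<Rightarrow> ('s \<Rightarrow> 't) \<times> ('l \<Rightarrow> 'k)) \<Rightarrow> bool" where
  "is_cocone J E D X k \<longleftrightarrow> (\<forall>j\<in>J. k j \<in> whdts_hom (D j) X) \<and>
     (\<forall>(i, f, j)\<in>E. whdts_comp (D i) (k j) f = k i)"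

lemma glue_states_respects:
  assumes "is_cocone J E D X k"
    "(a, b) \<in> {((i, s), (j, fst f s)) | i f j s. (i, f, j) \<in> E \<and> s \<in> states (D i)}"
  shows "(\<lambda>(j, s). fst (k j) s) a = (\<lambda>(j, s). fst (k j) s) b"
proof -
  obtain i f j s where a: "a = (i, s)" "b = (j, fst f s)" "(i, f, j) \<in> E" "s \<in> states (D i)"
    using assms(2) by blast
  then have "k i = whdts_comp (D i) (k j) f" using assms(1) by (fastforce simp: is_cocone_def)
  then show ?thesis using a by (simp add: whdts_comp_def compose_def)
qed

lemma glue_actions_respects:
  assumes "is_cocone J E D X k"
    "(a, b) \<in> {((i, u), (j, snd f u)) | i f j u. (i, f, j) \<in> E \<and> u \<in> actions (D i)}"
  shows "(\<lambda>(j, u). snd (k j) u) a = (\<lambda>(j, u). snd (k j) u) b"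
proof -
  obtain i f j u where a: "a = (i, u)" "b = (j, snd f u)" "(i, f, j) \<in> E" "u \<in> actions (D i)"
    using assms(2) by blast
  then have "k i = whdts_comp (D i) (k j) f" using assms(1) by (fastforce simp: is_cocone_def)
  then show ?thesis using a by (simp add: whdts_comp_def compose_def)
qed

lemma colim_labelling:
  assumes "is_diagram J E D" "j \<in> J" "u \<in> actions (D j)"
  shows "labelling (whdts_colim J E D) (glue_actions J E D `` {(j, u)}) = labelling (D j) u"
proof -
  let ?A = "SIGMA j:J. actions (D j)"
  let ?R = "{((i, u), (j, snd f u)) | i f j u. (i, f, j) \<in> E \<and> u \<in> actions (D i)}"
  have "labelling (D (fst a)) (snd a) = labelling (D (fst b)) (snd b)" if "(a, b) \<in> ?R" for a b
    using that assms(1) by (fastforce simp: is_diagram_def whdts_hom_def)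
  then have *: "labelling (D j) u = labelling (D (fst b)) (snd b)" if "((j, u), b) \<in> glue ?A ?R" for b
    using glue_respects[of "(j, u)" b ?A ?R "\<lambda>b. labelling (D (fst b)) (snd b)"] that by simp
  have self: "(j, u) \<in> glue ?A ?R `` {(j, u)}" using assms by (intro glue_self) auto
  have "(THE a. \<exists>(j', u') \<in> glue ?A ?R `` {(j, u)}. a = labelling (D j') u') = labelling (D j) u"
  proof (rule the_equality)
    show "\<exists>(j', u') \<in> glue ?A ?R `` {(j, u)}. labelling (D j) u = labelling (D j') u'"
      using self by (intro bexI[of _ "(j, u)"]) auto
  next
    fix a assume "\<exists>(j', u') \<in> glue ?A ?R `` {(j, u)}. a = labelling (D j') u'"
    then show "a = labelling (D j) u" using * by force
  qed
  then show ?thesis by (simp add: whdts_colim_def glue_actions_def)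
qed

lemma colim_carriers:
  "states (whdts_colim J E D) = {glue_states J E D `` {(j, s)} | j s. j \<in> J \<and> s \<in> states (D j)}"
  "actions (whdts_colim J E D) = {glue_actions J E D `` {(j, u)} | j u. j \<in> J \<and> u \<in> actions (D j)}"
  by (auto simp: whdts_colim_def quotient_def)

lemma is_whdts_colim:
  assumes "is_diagram J E D"
  shows "is_whdts (whdts_colim J E D)"
proof -
  let ?X = "whdts_colim J E D"
  let ?B = "{(glue_states J E D `` {(j, \<alpha>)}, map (\<lambda>u. glue_actions J E D `` {(j, u)}) us,
         glue_states J E D `` {(j, \<beta>)}) | j \<alpha> us \<beta>. j \<in> J \<and> (\<alpha>, us, \<beta>) \<in> transitions (D j)}"
  let ?U = "{(\<alpha>, us, \<beta>). \<alpha> \<in> states ?X \<and> \<beta> \<in> states ?X \<and> set us \<subseteq> actions ?X \<and> length us \<ge> 1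
     \<and> (id \<alpha>, map id us, id \<beta>) \<in> UNIV}"
  have t: "transitions ?X = whdts_closure ?B" by (simp add: whdts_colim_def)
  have "multiset_axiom ?U" "coherence_axiom ?U"
    by (rule multiset_axiom_vimage, simp add: multiset_axiom_def)
       (rule coherence_axiom_vimage, simp add: coherence_axiom_def)
  moreover have "?B \<subseteq> ?U"
  proof clarify
    fix j \<alpha> us \<beta> assume a: "j \<in> J" "(\<alpha>, us, \<beta>) \<in> transitions (D j)"
    then have "is_whdts (D j)" using assms by (auto simp: is_diagram_def)
    from is_whdtsD[OF this a(2)] a(1)
    show "glue_states J E D `` {(j, \<alpha>)} \<in> states ?X \<and> glue_states J E D `` {(j, \<beta>)} \<in> states ?X \<and>
       set (map (\<lambda>u. glue_actions J E D `` {(j, u)}) us) \<subseteq> actions ?X \<and>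
       1 \<le> length (map (\<lambda>u. glue_actions J E D `` {(j, u)}) us) \<and>
       (id (glue_states J E D `` {(j, \<alpha>)}), map id (map (\<lambda>u. glue_actions J E D `` {(j, u)}) us),
        id (glue_states J E D `` {(j, \<beta>)})) \<in> UNIV"
      by (auto simp: colim_carriers)
  qed
  ultimately have "transitions ?X \<subseteq> ?U" unfolding t by (rule whdts_closure_least)
  then show ?thesis unfolding is_whdts_def using whdts_closure_axioms[of ?B] t by auto
qed

lemma colim_coproj_cocone:
  assumes "is_diagram J E D"
  shows "is_cocone J E D (whdts_colim J E D) (whdts_coproj J E D)"
  unfolding is_cocone_def
proof (intro conjI ballI)
  fix j assume j: "j \<in> J"
  have D: "is_whdts (D j)" using j assms by (auto simp: is_diagram_def)
  have "(fst (whdts_coproj J E D j) \<alpha>, map (snd (whdts_coproj J E D j)) us,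
      fst (whdts_coproj J E D j) \<beta>) \<in> transitions (whdts_colim J E D)"
    if t: "(\<alpha>, us, \<beta>) \<in> transitions (D j)" for \<alpha> us \<beta>
  proof -
    have "map (snd (whdts_coproj J E D j)) us = map (\<lambda>u. glue_actions J E D `` {(j, u)}) us"
      using is_whdtsD(3)[OF D t] by (auto simp: whdts_coproj_def)
    moreover have "fst (whdts_coproj J E D j) \<alpha> = glue_states J E D `` {(j, \<alpha>)}"
      "fst (whdts_coproj J E D j) \<beta> = glue_states J E D `` {(j, \<beta>)}"
      using is_whdtsD(1,2)[OF D t] by (simp_all add: whdts_coproj_def)
    moreover have "(glue_states J E D `` {(j, \<alpha>)}, map (\<lambda>u. glue_actions J E D `` {(j, u)}) us,
        glue_states J E D `` {(j, \<beta>)}) \<in> transitions (whdts_colim J E D)"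
      unfolding whdts_colim_def whdts.simps using t j by (intro whdts_closure.base) blast
    ultimately show ?thesis by (simp only:)
  qed
  then have "(fst (whdts_coproj J E D j), snd (whdts_coproj J E D j))
      \<in> whdts_hom (D j) (whdts_colim J E D)"
    using j by (intro whdts_homI)
      (auto simp: whdts_coproj_def colim_carriers colim_labelling[OF assms])
  then show "whdts_coproj J E D j \<in> whdts_hom (D j) (whdts_colim J E D)" by simp
next
  fix e assume e: "e \<in> E"
  obtain i f g j where ijf: "e = (i, (f, g), j)" by (metis surj_pair)
  have h: "i \<in> J" "j \<in> J" "(f, g) \<in> whdts_hom (D i) (D j)"
    using assms e ijf by (auto simp: is_diagram_def)
  have "glue_states J E D `` {(j, f s)} = glue_states J E D `` {(i, s)}" if "s \<in> states (D i)" for s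
    unfolding glue_states_def using that h e ijf whdts_homD(5)[OF h(3)]
    by (intro glue_base[symmetric]) force+
  moreover have "glue_actions J E D `` {(j, g s)} = glue_actions J E D `` {(i, s)}"
    if "s \<in> actions (D i)" for s
    unfolding glue_actions_def using that h e ijf whdts_homD(6)[OF h(3)]
    by (intro glue_base[symmetric]) force+
  ultimately show "case e of (i, f, j) \<Rightarrow>
      whdts_comp (D i) (whdts_coproj J E D j) f = whdts_coproj J E D i"
    using whdts_homD(5,6)[OF h(3)]
    by (auto simp: ijf whdts_comp_def whdts_coproj_def compose_def fun_eq_iff)
qed

lemma colim_universal:
  assumes D: "is_diagram J E D" and X: "is_whdts X" and k: "is_cocone J E D X k"
  shows "\<exists>!h. h \<in> whdts_hom (whdts_colim J E D) X \<and>
           (\<forall>j\<in>J. whdts_comp (D j) h (whdts_coproj J E D j) = k j)"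
proof -
  let ?C = "whdts_colim J E D"
  let ?B = "{(glue_states J E D `` {(j, \<alpha>)}, map (\<lambda>u. glue_actions J E D `` {(j, u)}) us,
         glue_states J E D `` {(j, \<beta>)}) | j \<alpha> us \<beta>. j \<in> J \<and> (\<alpha>, us, \<beta>) \<in> transitions (D j)}"
  define f where "f = (\<lambda>c\<in>states ?C. the_elem ((\<lambda>(j, s). fst (k j) s) ` c))"
  define g where "g = (\<lambda>c\<in>actions ?C. the_elem ((\<lambda>(j, u). snd (k j) u) ` c))"
  have K: "(fst (k j), snd (k j)) \<in> whdts_hom (D j) X" if "j \<in> J" for j
    using that k by (auto simp: is_cocone_def)
  have cin: "glue_states J E D `` {(j, s)} \<in> states ?C" if "j \<in> J" "s \<in> states (D j)" for j s
    using that by (auto simp: colim_carriers)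
  have ain: "glue_actions J E D `` {(j, s)} \<in> actions ?C" if "j \<in> J" "s \<in> actions (D j)" for j s
    using that by (auto simp: colim_carriers)
  have f: "f (glue_states J E D `` {(j, s)}) = fst (k j) s" if "j \<in> J" "s \<in> states (D j)" for j s
  proof -
    have "the_elem ((\<lambda>(j, s). fst (k j) s) ` (glue_states J E D `` {(j, s)})) = (\<lambda>(j, s). fst (k j) s) (j, s)"
      unfolding glue_states_def by (rule glue_lift, erule glue_states_respects[OF k]) (use that in simp)
    then show ?thesis using cin[OF that] by (simp add: f_def)
  qed
  have g: "g (glue_actions J E D `` {(j, s)}) = snd (k j) s" if "j \<in> J" "s \<in> actions (D j)" for j s
  proof -
    have "the_elem ((\<lambda>(j, u). snd (k j) u) ` (glue_actions J E D `` {(j, s)})) = (\<lambda>(j, u). snd (k j) u) (j, s)"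
      unfolding glue_actions_def by (rule glue_lift, erule glue_actions_respects[OF k]) (use that in simp)
    then show ?thesis using ain[OF that] by (simp add: g_def)
  qed
  have fm: "f \<in> states ?C \<rightarrow>\<^sub>E states X"
  proof (rule PiE_I)
    fix c assume "c \<in> states ?C"
    then obtain j s where "c = glue_states J E D `` {(j, s)}" "j \<in> J" "s \<in> states (D j)"
      unfolding colim_carriers by blast
    then show "f c \<in> states X" using f whdts_homD(5)[OF K] by simp
  qed (simp add: f_def)
  have gm: "g \<in> actions ?C \<rightarrow>\<^sub>E actions X"
  proof (rule PiE_I)
    fix c assume "c \<in> actions ?C"
    then obtain j s where "c = glue_actions J E D `` {(j, s)}" "j \<in> J" "s \<in> actions (D j)"
      unfolding colim_carriers by blast
    then show "g c \<in> actions X" using g whdts_homD(6)[OF K] by simp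
  qed (simp add: g_def)
  have gl: "labelling X (g c) = labelling ?C c" if c: "c \<in> actions ?C" for c
  proof -
    obtain j s where "c = glue_actions J E D `` {(j, s)}" "j \<in> J" "s \<in> actions (D j)"
      using c unfolding colim_carriers by blast
    then show ?thesis using g whdts_homD(3)[OF K] colim_labelling[OF D] by simp
  qed
  let ?U = "{(\<alpha>, us, \<beta>). \<alpha> \<in> states ?C \<and> \<beta> \<in> states ?C \<and> set us \<subseteq> actions ?C \<and> length us \<ge> 1
     \<and> (f \<alpha>, map g us, f \<beta>) \<in> transitions X}"
  have "?B \<subseteq> ?U"
  proof clarify
    fix j \<alpha> us \<beta> assume a: "j \<in> J" "(\<alpha>, us, \<beta>) \<in> transitions (D j)"
    then have "is_whdts (D j)" using D by (auto simp: is_diagram_def)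
    note d = is_whdtsD[OF this a(2)]
    have "map g (map (\<lambda>u. glue_actions J E D `` {(j, u)}) us) = map (snd (k j)) us"
      using d(3) g[OF a(1)] by auto
    note m = this
    show "glue_states J E D `` {(j, \<alpha>)} \<in> states ?C \<and> glue_states J E D `` {(j, \<beta>)} \<in> states ?C \<and>
       set (map (\<lambda>u. glue_actions J E D `` {(j, u)}) us) \<subseteq> actions ?C \<and>
       1 \<le> length (map (\<lambda>u. glue_actions J E D `` {(j, u)}) us) \<and>
       (f (glue_states J E D `` {(j, \<alpha>)}), map g (map (\<lambda>u. glue_actions J E D `` {(j, u)}) us),
        f (glue_states J E D `` {(j, \<beta>)})) \<in> transitions X"
      unfolding m f[OF a(1) d(1)] f[OF a(1) d(2)]
      using d a(1) cin[OF a(1)] ain[OF a(1)] whdts_homD(4)[OF K[OF a(1)] a(2)] by auto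
  qed
  moreover have "multiset_axiom (transitions X)" "coherence_axiom (transitions X)"
    using X by (simp_all add: is_whdts_def)
  ultimately have "whdts_closure ?B \<subseteq> ?U"
    by (intro whdts_closure_least multiset_axiom_vimage coherence_axiom_vimage)
  then have "transitions ?C \<subseteq> ?U" by (simp add: whdts_colim_def)
  with fm gm gl have hom: "(f, g) \<in> whdts_hom ?C X" by (intro whdts_homI) auto
  have fact: "whdts_comp (D j) (f, g) (whdts_coproj J E D j) = k j" if "j \<in> J" for j
  proof (rule prod_eqI)
    show "fst (whdts_comp (D j) (f, g) (whdts_coproj J E D j)) = fst (k j)"
      using f[OF that] whdts_homD(1)[OF K[OF that]]
      by (auto simp: whdts_comp_def whdts_coproj_def compose_def fun_eq_iff PiE_def extensional_def)
    show "snd (whdts_comp (D j) (f, g) (whdts_coproj J E D j)) = snd (k j)"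
      using g[OF that] whdts_homD(2)[OF K[OF that]]
      by (auto simp: whdts_comp_def whdts_coproj_def compose_def fun_eq_iff PiE_def extensional_def)
  qed
  show ?thesis
  proof (rule ex1I[of _ "(f, g)"])
    show "(f, g) \<in> whdts_hom ?C X \<and>
        (\<forall>j\<in>J. whdts_comp (D j) (f, g) (whdts_coproj J E D j) = k j)"
      using hom fact by blast
  next
    fix h assume h: "h \<in> whdts_hom ?C X \<and>
        (\<forall>j\<in>J. whdts_comp (D j) h (whdts_coproj J E D j) = k j)"
    then have H: "(fst h, snd h) \<in> whdts_hom ?C X" by simp
    have eq: "whdts_comp (D j) h (whdts_coproj J E D j) = k j" if "j \<in> J" for j using h that by blast
    have 0: "fst h (glue_states J E D `` {(j, s)}) = fst (k j) s" if "j \<in> J" "s \<in> states (D j)" for j s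
      using arg_cong[OF eq[OF that(1)], of "\<lambda>h. fst h s"] that(2)
      by (simp add: whdts_comp_def whdts_coproj_def compose_def)
    have 1: "snd h (glue_actions J E D `` {(j, s)}) = snd (k j) s" if "j \<in> J" "s \<in> actions (D j)" for j s
      using arg_cong[OF eq[OF that(1)], of "\<lambda>h. snd h s"] that(2)
      by (simp add: whdts_comp_def whdts_coproj_def compose_def)
    show "h = (f, g)"
    proof (rule prod_eqI; simp)
      show "fst h = f"
      proof (rule PiE_ext[OF whdts_homD(1)[OF H] fm])
        fix c assume "c \<in> states ?C"
        then obtain j s where "c = glue_states J E D `` {(j, s)}" "j \<in> J" "s \<in> states (D j)"
          unfolding colim_carriers by blast
        then show "fst h c = f c" using 0 f by simp
      qed
      show "snd h = g"
      proof (rule PiE_ext[OF whdts_homD(2)[OF H] gm])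
        fix c assume "c \<in> actions ?C"
        then obtain j s where "c = glue_actions J E D `` {(j, s)}" "j \<in> J" "s \<in> actions (D j)"
          unfolding colim_carriers by blast
        then show "snd h c = g c" using 1 g by simp
      qed
    qed
  qed
qed


section \<open>The cubes \<open>Cn\<close> and their maps\<close>

lemma Cn_transitions_iff:
  "(e, us, e') \<in> transitions (Cn a) \<longleftrightarrow>
     e \<in> cube (length a) \<and> e' \<in> cube (length a) \<and>
     us = map (\<lambda>i. (a ! i, i)) (map snd us) \<and> length us \<ge> 1 \<and> distinct (map snd us) \<and>
     set (map snd us) \<subseteq> {..<length a} \<and>
     (\<forall>i<length a. e ! i \<le> e' ! i) \<and>
     (\<forall>i<length a. e ! i \<noteq> e' ! i \<longleftrightarrow> i \<in> set (map snd us))"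
proof -
  have *: "map snd (map (\<lambda>i. (a ! i, i)) is) = is" for "is" by (simp add: o_def)
  show ?thesis (is "?l \<longleftrightarrow> ?r")
  proof
    assume ?l
    then obtain "is" where us: "us = map (\<lambda>i. (a ! i, i)) is" and r: "e \<in> cube (length a)" "e' \<in> cube (length a)"
        "length is \<ge> 1" "distinct is" "set is \<subseteq> {..<length a}"
        "\<forall>i<length a. e ! i \<le> e' ! i" "\<forall>i<length a. e ! i \<noteq> e' ! i \<longleftrightarrow> i \<in> set is"
      by (auto simp: Cn_def)
    have ms: "map snd us = is" unfolding us by (rule *)
    have "length us \<ge> 1" using r(3) us by simp
    with us r show ?r unfolding ms by blast
  next
    assume ?r
    then have "e \<in> cube (length a) \<and> e' \<in> cube (length a) \<and>
        length (map snd us) \<ge> 1 \<and> distinct (map snd us) \<and> set (map snd us) \<subseteq> {..<length a} \<and>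
        (\<forall>i<length a. e ! i \<le> e' ! i) \<and>
        (\<forall>i<length a. e ! i \<noteq> e' ! i \<longleftrightarrow> i \<in> set (map snd us))"
      and "us = map (\<lambda>i. (a ! i, i)) (map snd us)" by simp_all
    then show ?l unfolding Cn_def whdts.simps by blast
  qed
qed

lemma is_whdts_Cn: "is_whdts (Cn a)"
  unfolding is_whdts_def
proof (intro conjI)
  let ?g = "\<lambda>i. (a ! i, i)"
  show "\<forall>(\<alpha>, us, \<beta>)\<in>transitions (Cn a). \<alpha> \<in> states (Cn a) \<and> \<beta> \<in> states (Cn a) \<and>
      set us \<subseteq> actions (Cn a) \<and> 1 \<le> length us"
    by (auto simp: Cn_def)
  show "multiset_axiom (transitions (Cn a))"
    unfolding multiset_axiom_def
  proof (intro allI impI, elim conjE)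
    fix e us e' \<sigma> assume t: "(e, us, e') \<in> transitions (Cn a)" and s: "\<sigma> permutes {..<length us}"
    note T = t[unfolded Cn_transitions_iff]
    have m: "map snd (permute_list \<sigma> us) = permute_list \<sigma> (map snd us)"
      by (rule permute_list_map[OF s, symmetric])
    have s': "\<sigma> permutes {..<length (map snd us)}" using s by simp
    have 1: "set (map snd (permute_list \<sigma> us)) = set (map snd us)"
      "distinct (map snd (permute_list \<sigma> us))"
      using T unfolding m by (simp_all only: set_permute_list[OF s'] distinct_permute_list[OF s'])
    have "permute_list \<sigma> us = permute_list \<sigma> (map ?g (map snd us))" using T by simp
    also have "\<dots> = map ?g (map snd (permute_list \<sigma> us))" unfolding m by (rule permute_list_map[OF s'])
    finally have 2: "permute_list \<sigma> us = map ?g (map snd (permute_list \<sigma> us))" .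
    show "(e, permute_list \<sigma> us, e') \<in> transitions (Cn a)"
      unfolding Cn_transitions_iff 1(1) length_permute_list using T 1(2) 2 by blast
  qed
  show "coherence_axiom (transitions (Cn a))"
    unfolding coherence_axiom_def
  proof (intro allI impI, elim conjE)
    fix e us e' \<nu>1 \<nu>2 and p q :: nat
    assume l: "length us \<ge> 3" "p \<ge> 1" "q \<ge> 1" "p + q < length us"
      and t: "(e, us, e') \<in> transitions (Cn a)" "(e, take p us, \<nu>1) \<in> transitions (Cn a)"
        "(e, take (p + q) us, \<nu>2) \<in> transitions (Cn a)"
    define js where "js = map snd us"
    have T: "us = map ?g js" "distinct js" "set js \<subseteq> {..<length a}"
      using t(1) unfolding js_def Cn_transitions_iff by blast+
    have T1: "\<nu>1 \<in> cube (length a)" "\<forall>i<length a. e ! i \<le> \<nu>1 ! i"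
        "\<forall>i<length a. e ! i \<noteq> \<nu>1 ! i \<longleftrightarrow> i \<in> set (take p js)"
      using t(2) unfolding js_def Cn_transitions_iff take_map by blast+
    have T2: "\<nu>2 \<in> cube (length a)" "\<forall>i<length a. e ! i \<le> \<nu>2 ! i"
        "\<forall>i<length a. e ! i \<noteq> \<nu>2 ! i \<longleftrightarrow> i \<in> set (take (p + q) js)"
      using t(3) unfolding js_def Cn_transitions_iff take_map by blast+
    define ks where "ks = take q (drop p js)"
    have tk: "take (p + q) js = take p js @ ks" by (simp add: take_add ks_def)
    have dj: "distinct (take p js @ ks)" unfolding tk[symmetric] using T(2) by (rule distinct_take)
    have kus: "take q (drop p us) = map ?g ks" using T(1) by (simp add: take_map drop_map ks_def)
    have "map snd (take q (drop p us)) = ks" unfolding kus by (simp add: o_def)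
    moreover have "length ks \<ge> 1" using l by (simp add: ks_def js_def)
    moreover have "set ks \<subseteq> {..<length a}" using T(3) unfolding ks_def
      by (meson order.trans set_drop_subset set_take_subset)
    moreover have "\<nu>1 ! i \<le> \<nu>2 ! i \<and> (\<nu>1 ! i \<noteq> \<nu>2 ! i \<longleftrightarrow> i \<in> set ks)" if "i < length a" for i
      using T1(2,3)[rule_format, OF that] T2(2,3)[rule_format, OF that] dj unfolding tk by auto
    ultimately show "(\<nu>1, take q (drop p us), \<nu>2) \<in> transitions (Cn a)"
      unfolding Cn_transitions_iff using T1(1) T2(1) dj kus by auto
  qed
qed

lemma length_pull_words [simp]: "length (pull words m n f w) = m"
  by (simp add: words_def)

lemma nth_pull_words [simp]: "i < m \<Longrightarrow> pull words m n f w ! i = w ! hat_inv m n f i"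
  by (simp add: words_def)

lemma Cn_simps [simp]:
  "states (Cn a) = cube (length a)" "actions (Cn a) = {(a ! i, i) | i. i < length a}"
  "labelling (Cn a) = fst"
  by (simp_all add: Cn_def)

lemma Cn_map_simps:
  "fst (Cn_map m f b) = f"
  "i < m \<Longrightarrow> snd (Cn_map m f b) (b ! hat_inv m (length b) f i, i)
     = (b ! hat_inv m (length b) f i, hat_inv m (length b) f i)"
  by (auto simp: Cn_map_def Let_def)

lemma Cn_map_hom:
  assumes f: "box_mor m (length b) f"
  shows "Cn_map m f b \<in> whdts_hom (Cn (pull words m (length b) f b)) (Cn b)"
proof -
  let ?n = "length b"
  let ?a = "pull words m ?n f b"
  let ?h = "hat_inv m ?n f"
  note h = hat_inv_properties[OF f]
  have "(fst (Cn_map m f b), snd (Cn_map m f b)) \<in> whdts_hom (Cn ?a) (Cn b)"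
  proof (rule whdts_homI)
    show "fst (Cn_map m f b) \<in> states (Cn ?a) \<rightarrow>\<^sub>E states (Cn b)"
      using box_mor_map[OF f] by (simp add: Cn_map_simps)
    show "snd (Cn_map m f b) \<in> actions (Cn ?a) \<rightarrow>\<^sub>E actions (Cn b)"
      using h(1) by (auto simp: Cn_map_def Let_def)
    show "labelling (Cn b) (snd (Cn_map m f b) u) = labelling (Cn ?a) u" if "u \<in> actions (Cn ?a)" for u
      using that by (auto simp: Cn_map_simps)
  next
    fix e us e' assume t: "(e, us, e') \<in> transitions (Cn ?a)"
    define js where "js = map snd us"
    have T: "e \<in> cube m" "e' \<in> cube m" "us = map (\<lambda>i. (?a ! i, i)) js" "length js \<ge> 1"
      "distinct js" "set js \<subseteq> {..<m}" "\<forall>i<m. e ! i \<le> e' ! i"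
      "\<forall>i<m. e ! i \<noteq> e' ! i \<longleftrightarrow> i \<in> set js"
      using t unfolding Cn_transitions_iff js_def length_pull_words length_map by blast+
    have us: "map (snd (Cn_map m f b)) us = map (\<lambda>j. (b ! j, j)) (map ?h js)"
      using T(6) by (auto simp: T(3) Cn_map_simps subset_eq)
    have dj: "distinct (map ?h js)"
    proof -
      have "inj_on ?h (set js)"
        by (rule inj_onI, rule hat_inv_inj[OF f]) (use T(6) in auto)
      then show ?thesis using T(5) by (simp add: distinct_map)
    qed
    have sj: "set (map ?h js) \<subseteq> {..<?n}" using T(6) h(1) by auto
    have st: "f e ! j \<le> f e' ! j \<and> (f e ! j \<noteq> f e' ! j \<longleftrightarrow> j \<in> set (map ?h js))" if j: "j < ?n" for j
    proof (cases "hat m f j")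
      case (Ix i)
      then have i: "i < m" using hat_properties(1)[OF f j] by (auto simp: coords_def)
      have ji: "?h i = j" using hat_properties(3)[OF f i] h[OF i] Ix j by blast
      have "f e ! j = e ! i" "f e' ! j = e' ! i"
        using hat_properties(2)[OF f j] T(1,2) Ix by simp_all
      moreover have "j \<in> set (map ?h js) \<longleftrightarrow> i \<in> set js"
        using hat_inv_inj[OF f] i ji T(6) by auto
      ultimately show ?thesis using T(7,8) i by simp
    next
      case MInf
      then have "j \<notin> set (map ?h js)" using h(2) T(6) by fastforce
      then show ?thesis using hat_properties(2)[OF f j] T(1,2) MInf by simp
    next
      case PInf
      then have "j \<notin> set (map ?h js)" using h(2) T(6) by fastforce
      then show ?thesis using hat_properties(2)[OF f j] T(1,2) PInf by simp
    qed
    have ms: "map snd (map (snd (Cn_map m f b)) us) = map ?h js" unfolding us by (simp add: o_def)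
    have len: "length (map (snd (Cn_map m f b)) us) \<ge> 1" using T(4) by (simp add: js_def)
    have "f e \<in> cube ?n" "f e' \<in> cube ?n" using box_mor_cube[OF f] T(1,2) by auto
    with us len dj sj st show "(fst (Cn_map m f b) e, map (snd (Cn_map m f b)) us, fst (Cn_map m f b) e')
        \<in> transitions (Cn b)"
      unfolding Cn_transitions_iff Cn_map_simps(1) ms by blast
  qed
  then show ?thesis by simp
qed

lemma Cn_map_ident: "Cn_map (length b) (\<lambda>e\<in>cube (length b). e) b = whdts_id (Cn b)"
proof -
  have "pull words (length b) (length b) (\<lambda>e\<in>cube (length b). e) b = b"
    using is_spsD(2)[OF is_sps_words, of b "length b"] by (simp add: words_def)
  then show ?thesis
    by (auto simp: Cn_map_def whdts_id_def Let_def hat_inv_ident intro!: restrict_ext)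
qed

lemma Cn_map_comp:
  assumes f: "box_mor k m f" and g: "box_mor m (length b) g"
  shows "Cn_map k (compose (cube k) g f) b =
    whdts_comp (Cn (pull words k m f (pull words m (length b) g b)))
      (Cn_map m g b) (Cn_map k f (pull words m (length b) g b))"
    (is "?l = whdts_comp (Cn ?c) ?r1 ?r2")
proof (rule prod_eqI)
  have c: "pull words k (length b) (compose (cube k) g f) b = ?c"
    using is_spsD(3)[OF is_sps_words f g, of b] by (simp add: words_def)
  show "fst ?l = fst (whdts_comp (Cn ?c) ?r1 ?r2)"
    by (simp add: Cn_map_simps whdts_comp_def)
  show "snd ?l = snd (whdts_comp (Cn ?c) ?r1 ?r2)"
  proof
    fix u
    show "snd ?l u = snd (whdts_comp (Cn ?c) ?r1 ?r2) u"
    proof (cases "u \<in> actions (Cn ?c)")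
      case True
      then obtain i where i: "i < k" "u = (?c ! i, i)" by auto
      have hi: "hat_inv k m f i < m" by (rule hat_inv_properties(1)[OF f i(1)])
      have u: "u = (b ! hat_inv k (length b) (compose (cube k) g f) i, i)"
        using i hi hat_inv_comp[OF f g i(1)] by simp
      have u': "u = (pull words m (length b) g b ! hat_inv k m f i, i)" using i by simp
      have "snd ?r2 u = (b ! hat_inv m (length b) g (hat_inv k m f i), hat_inv k m f i)"
        unfolding u' using Cn_map_simps(2)[OF i(1), where f = f and b = "pull words m (length b) g b"] hi by simp
      then have "snd (whdts_comp (Cn ?c) ?r1 ?r2) u =
          (b ! hat_inv m (length b) g (hat_inv k m f i), hat_inv m (length b) g (hat_inv k m f i))"
        using True Cn_map_simps(2)[OF hi] by (simp add: whdts_comp_def compose_def del: Cn_simps(2))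
      also have "\<dots> = snd ?l u" unfolding u Cn_map_simps(2)[OF i(1)]
        using hat_inv_comp[OF f g i(1)] by simp
      finally show ?thesis by simp
    next
      case False
      then show ?thesis using c by (simp add: Cn_map_def whdts_comp_def compose_def restrict_def del: Cn_simps(2))
    qed
  qed
qed


section \<open>Characterisation of the functor\<close>

lemma is_lspsD:
  assumes "is_lsps K"
  shows "is_sps K" "x \<in> cubes K n \<Longrightarrow> length (lab K n x) = n"
    "box_mor m n f \<Longrightarrow> x \<in> cubes K n \<Longrightarrow> lab K m (pull K m n f x) = pull words m n f (lab K n x)"
  using assms by (auto simp: is_lsps_def sps_hom_def words_def)

lemma lsps_homD:
  assumes "\<phi> \<in> lsps_hom K L"
  shows "x \<in> cubes K n \<Longrightarrow> \<phi> n x \<in> cubes L n"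
    "box_mor m n f \<Longrightarrow> x \<in> cubes K n \<Longrightarrow> \<phi> m (pull K m n f x) = pull L m n f (\<phi> n x)"
    "x \<in> cubes K n \<Longrightarrow> lab L n (\<phi> n x) = lab K n x"
  using assms by (auto simp: lsps_hom_def sps_hom_def)

lemma elements_diagram:
  assumes K: "is_lsps K"
  shows "is_diagram (elements K) (element_arrows K) (element_cube K)"
  unfolding is_diagram_def
proof (intro conjI ballI)
  show "is_whdts (element_cube K j)" for j by (cases j) (simp add: element_cube_def is_whdts_Cn)
next
  fix e assume "e \<in> element_arrows K"
  then obtain m n f x where e: "e = ((m, pull K m n f x), Cn_map m f (lab K n x), (n, x))"
    and fx: "box_mor m n f" "x \<in> cubes K n" unfolding element_arrows_def by blast
  have "Cn_map m f (lab K n x) \<in> whdts_hom (Cn (lab K m (pull K m n f x))) (Cn (lab K n x))"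
    using Cn_map_hom[of m "lab K n x" f] fx is_lspsD(2,3)[OF K] by simp
  then show "case e of (i, f, j) \<Rightarrow> i \<in> elements K \<and> j \<in> elements K \<and>
      f \<in> whdts_hom (element_cube K i) (element_cube K j)"
    using fx is_spsD(1)[OF is_lspsD(1)[OF K] fx] by (simp add: e elements_def element_cube_def)
qed

lemma is_whdts_T_obj: "is_lsps K \<Longrightarrow> is_whdts (T_obj K)"
  unfolding T_obj_def by (intro is_whdts_colim elements_diagram)

lemma elements_cocone_iff:
  assumes "is_lsps K"
  shows "is_cocone (elements K) (element_arrows K) (element_cube K) X k \<longleftrightarrow>
    (\<forall>n. \<forall>x\<in>cubes K n. k (n, x) \<in> whdts_hom (Cn (lab K n x)) X) \<and>
    (\<forall>m n. \<forall>f\<in>box m n. \<forall>x\<in>cubes K n.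
       whdts_comp (Cn (pull words m n f (lab K n x))) (k (n, x)) (Cn_map m f (lab K n x))
       = k (m, pull K m n f x))" (is "_ \<longleftrightarrow> ?A \<and> ?B")
proof -
  have "(\<forall>(i, f, j)\<in>element_arrows K. whdts_comp (element_cube K i) (k j) f = k i) \<longleftrightarrow>
    (\<forall>m n f x. f \<in> box m n \<and> x \<in> cubes K n \<longrightarrow>
      whdts_comp (element_cube K (m, pull K m n f x)) (k (n, x)) (Cn_map m f (lab K n x))
        = k (m, pull K m n f x))"
    unfolding element_arrows_def by blast
  also have "\<dots> \<longleftrightarrow> ?B" using is_lspsD(3)[OF assms] by (auto simp: element_cube_def)
  finally show ?thesis by (auto simp: is_cocone_def elements_def element_cube_def)
qed

lemma T_coproj_cocone:
  assumes "is_lsps K"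
  shows "x \<in> cubes K n \<Longrightarrow> T_coproj K n x \<in> whdts_hom (Cn (lab K n x)) (T_obj K)"
    "box_mor m n f \<Longrightarrow> x \<in> cubes K n \<Longrightarrow>
       whdts_comp (Cn (pull words m n f (lab K n x))) (T_coproj K n x) (Cn_map m f (lab K n x))
       = T_coproj K m (pull K m n f x)"
  using colim_coproj_cocone[OF elements_diagram[OF assms]]
  unfolding elements_cocone_iff[OF assms] T_coproj_def T_obj_def by simp_all

lemma T_obj_universal:
  assumes K: "is_lsps K" and X: "is_whdts X"
    and k: "\<And>n x. x \<in> cubes K n \<Longrightarrow> k n x \<in> whdts_hom (Cn (lab K n x)) X"
    and kk: "\<And>m n f x. box_mor m n f \<Longrightarrow> x \<in> cubes K n \<Longrightarrow>
       whdts_comp (Cn (pull words m n f (lab K n x))) (k n x) (Cn_map m f (lab K n x))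
       = k m (pull K m n f x)"
  shows "\<exists>!h. h \<in> whdts_hom (T_obj K) X \<and>
     (\<forall>n. \<forall>x\<in>cubes K n. whdts_comp (Cn (lab K n x)) h (T_coproj K n x) = k n x)"
proof -
  have c: "is_cocone (elements K) (element_arrows K) (element_cube K) X (\<lambda>(n, x). k n x)"
    unfolding elements_cocone_iff[OF K] using k kk by simp
  have "(\<forall>j\<in>elements K. whdts_comp (element_cube K j) h
           (whdts_coproj (elements K) (element_arrows K) (element_cube K) j) = (\<lambda>(n, x). k n x) j)
     \<longleftrightarrow> (\<forall>n. \<forall>x\<in>cubes K n. whdts_comp (Cn (lab K n x)) h (T_coproj K n x) = k n x)" for h
    by (auto simp: elements_def T_coproj_def element_cube_def)
  with colim_universal[OF elements_diagram[OF K] X c] show ?thesis unfolding T_obj_def by simp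
qed

lemma T_hom_ext:
  assumes K: "is_lsps K" and X: "is_whdts X" and h: "h \<in> whdts_hom (T_obj K) X" "h' \<in> whdts_hom (T_obj K) X"
    and eq: "\<And>n x. x \<in> cubes K n \<Longrightarrow>
      whdts_comp (Cn (lab K n x)) h (T_coproj K n x) = whdts_comp (Cn (lab K n x)) h' (T_coproj K n x)"
  shows "h = h'"
proof -
  let ?k = "\<lambda>n x. whdts_comp (Cn (lab K n x)) h' (T_coproj K n x)"
  have "?k n x \<in> whdts_hom (Cn (lab K n x)) X" if "x \<in> cubes K n" for n x
    by (rule whdts_comp_hom[OF is_whdts_Cn T_coproj_cocone(1)[OF K that] h(2)])
  moreover have "whdts_comp (Cn (pull words m n f (lab K n x))) (?k n x) (Cn_map m f (lab K n x))
       = ?k m (pull K m n f x)" if fx: "box_mor m n f" "x \<in> cubes K n" for m n f x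
  proof -
    have "Cn_map m f (lab K n x) \<in> whdts_hom (Cn (pull words m n f (lab K n x))) (Cn (lab K n x))"
      using Cn_map_hom[of m "lab K n x" f] fx is_lspsD(2)[OF K fx(2)] by simp
    from whdts_comp_assoc[OF this, of h' "T_coproj K n x"] show ?thesis
      using T_coproj_cocone(2)[OF K fx] is_lspsD(3)[OF K fx] by simp
  qed
  ultimately have "\<exists>!h. h \<in> whdts_hom (T_obj K) X \<and>
     (\<forall>n. \<forall>x\<in>cubes K n. whdts_comp (Cn (lab K n x)) h (T_coproj K n x) = ?k n x)"
    by (intro T_obj_universal[OF K X])
  then show ?thesis using h eq by blast
qed

lemma T_coproj_simps:
  assumes "x \<in> cubes K n"
  shows "s \<in> cube (length (lab K n x)) \<Longrightarrow> fst (T_coproj K n x) s =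
      glue_states (elements K) (element_arrows K) (element_cube K) `` {((n, x), s)}"
    "u \<in> actions (Cn (lab K n x)) \<Longrightarrow> snd (T_coproj K n x) u =
      glue_actions (elements K) (element_arrows K) (element_cube K) `` {((n, x), u)}"
  by (simp_all add: T_coproj_def whdts_coproj_def element_cube_def)

lemma T_obj_carriers:
  "c \<in> states (T_obj K) \<longleftrightarrow>
     (\<exists>n x s. x \<in> cubes K n \<and> s \<in> cube (length (lab K n x)) \<and> c = fst (T_coproj K n x) s)"
  "d \<in> actions (T_obj K) \<longleftrightarrow>
     (\<exists>n x u. x \<in> cubes K n \<and> u \<in> actions (Cn (lab K n x)) \<and> d = snd (T_coproj K n x) u)"
  unfolding T_obj_def colim_carriers
  by (fastforce simp: elements_def element_cube_def T_coproj_simps)+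

lemma T_mor_class:
  assumes K: "is_lsps K" and L: "is_lsps L" and \<phi>: "\<phi> \<in> lsps_hom K L" and x: "x \<in> cubes K n"
  shows "s \<in> cube (length (lab K n x)) \<Longrightarrow>
      fst (T_mor K L \<phi>) (fst (T_coproj K n x) s) = fst (T_coproj L n (\<phi> n x)) s"
    "u \<in> actions (Cn (lab K n x)) \<Longrightarrow>
      snd (T_mor K L \<phi>) (snd (T_coproj K n x) u) = snd (T_coproj L n (\<phi> n x)) u"
proof -
  note H = lsps_homD[OF \<phi>]
  have arr: "((m, \<phi> m y), f, (l, \<phi> l z)) \<in> element_arrows L"
    if "((m, y), f, (l, z)) \<in> element_arrows K" for m y f l z
    using that H by (fastforce simp: element_arrows_def)
  have src: "element_cube L (m, \<phi> m y) = element_cube K (m, y)"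
    if "((m, y), f, (l, z)) \<in> element_arrows K" for m y f l z
    using that H(3) is_spsD(1)[OF is_lspsD(1)[OF K]]
    by (force simp: element_arrows_def element_cube_def)
  {
    assume s: "s \<in> cube (length (lab K n x))"
    have "fst (T_mor K L \<phi>) (fst (T_coproj K n x) s) =
        glue_states (elements L) (element_arrows L) (element_cube L) ``
          (relabel \<phi> ` (glue_states (elements K) (element_arrows K) (element_cube K) `` {((n, x), s)}))"
    proof -
      have "fst (T_coproj K n x) s \<in> states (T_obj K)" using s x unfolding T_obj_carriers by blast
      then show ?thesis by (simp add: T_mor_def T_coproj_simps(1)[OF x s])
    qed
    also have "\<dots> = glue_states (elements L) (element_arrows L) (element_cube L) `` {relabel \<phi> ((n, x), s)}"
      unfolding glue_states_def
    proof (rule glue_mono_image)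
      show "relabel \<phi> a \<in> (SIGMA j:elements L. states (element_cube L j))"
        if "a \<in> (SIGMA j:elements K. states (element_cube K j))" for a
        using that H(1,3) by (auto simp: relabel_def elements_def element_cube_def)
      show "((n, x), s) \<in> (SIGMA j:elements K. states (element_cube K j))"
        using s x by (simp add: elements_def element_cube_def)
      fix a b assume "(a, b) \<in> {((i, s), (j, fst f s)) | i f j s.
          (i, f, j) \<in> element_arrows K \<and> s \<in> states (element_cube K i)}"
      then obtain i j f s where ij: "a = (i, s)" "b = (j, fst f s)"
        "(i, f, j) \<in> element_arrows K" "s \<in> states (element_cube K i)" by blast
      obtain m y l z where "i = (m, y)" "j = (l, z)" by (cases i, cases j)
      note ab = ij[unfolded \<open>i = (m, y)\<close> \<open>j = (l, z)\<close>]
      show "(relabel \<phi> a, relabel \<phi> b) \<in> {((i, s), (j, fst f s)) | i f j s.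
          (i, f, j) \<in> element_arrows L \<and> s \<in> states (element_cube L i)}"
        using arr[OF ab(3)] ab(4)[folded src[OF ab(3)]]
        unfolding ab(1,2) relabel_def case_prod_conv by blast
    qed
    also have "\<dots> = fst (T_coproj L n (\<phi> n x)) s"
      using s H x by (simp add: relabel_def T_coproj_simps)
    finally show "fst (T_mor K L \<phi>) (fst (T_coproj K n x) s) = fst (T_coproj L n (\<phi> n x)) s" .
  }
  {
    assume u: "u \<in> actions (Cn (lab K n x))"
    have "snd (T_mor K L \<phi>) (snd (T_coproj K n x) u) =
        glue_actions (elements L) (element_arrows L) (element_cube L) ``
          (relabel \<phi> ` (glue_actions (elements K) (element_arrows K) (element_cube K) `` {((n, x), u)}))"
    proof -
      have "snd (T_coproj K n x) u \<in> actions (T_obj K)" using u x unfolding T_obj_carriers by blast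
      then show ?thesis by (simp add: T_mor_def T_coproj_simps(2)[OF x u])
    qed
    also have "\<dots> = glue_actions (elements L) (element_arrows L) (element_cube L) `` {relabel \<phi> ((n, x), u)}"
      unfolding glue_actions_def
    proof (rule glue_mono_image)
      show "relabel \<phi> a \<in> (SIGMA j:elements L. actions (element_cube L j))"
        if "a \<in> (SIGMA j:elements K. actions (element_cube K j))" for a
        using that H(1,3) by (auto simp: relabel_def elements_def element_cube_def)
      show "((n, x), u) \<in> (SIGMA j:elements K. actions (element_cube K j))"
        using u x by (simp add: elements_def element_cube_def)
      fix a b assume "(a, b) \<in> {((i, s), (j, snd f s)) | i f j s.
          (i, f, j) \<in> element_arrows K \<and> s \<in> actions (element_cube K i)}"
      then obtain i j f s where ij: "a = (i, s)" "b = (j, snd f s)"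
        "(i, f, j) \<in> element_arrows K" "s \<in> actions (element_cube K i)" by blast
      obtain m y l z where "i = (m, y)" "j = (l, z)" by (cases i, cases j)
      note ab = ij[unfolded \<open>i = (m, y)\<close> \<open>j = (l, z)\<close>]
      show "(relabel \<phi> a, relabel \<phi> b) \<in> {((i, s), (j, snd f s)) | i f j s.
          (i, f, j) \<in> element_arrows L \<and> s \<in> actions (element_cube L i)}"
        using arr[OF ab(3)] ab(4)[folded src[OF ab(3)]]
        unfolding ab(1,2) relabel_def case_prod_conv by blast
    qed
    also have "\<dots> = snd (T_coproj L n (\<phi> n x)) u"
      using u H x by (simp add: relabel_def T_coproj_simps del: Cn_simps(2))
    finally show "snd (T_mor K L \<phi>) (snd (T_coproj K n x) u) = snd (T_coproj L n (\<phi> n x)) u" .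
  }
qed

lemma whdts_comp_eqI:
  assumes "h \<in> whdts_hom X Y" "\<And>s. s \<in> states X \<Longrightarrow> fst g (fst f s) = fst h s"
    "\<And>u. u \<in> actions X \<Longrightarrow> snd g (snd f u) = snd h u"
  shows "whdts_comp X g f = h"
  using assms by (auto simp: whdts_comp_def whdts_hom_def compose_def fun_eq_iff PiE_def extensional_def
      intro!: prod_eqI)

lemma T_mor_coproj:
  assumes "is_lsps K" "is_lsps L" "\<phi> \<in> lsps_hom K L" "x \<in> cubes K n"
  shows "whdts_comp (Cn (lab K n x)) (T_mor K L \<phi>) (T_coproj K n x) = T_coproj L n (\<phi> n x)"
  using T_mor_class[OF assms] T_coproj_cocone(1)[OF assms(2), of "\<phi> n x" n] lsps_homD[OF assms(3)] assms(4)
  by (intro whdts_comp_eqI[of _ _ "T_obj L"]) (simp_all del: Cn_simps(2))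

lemma T_mor_hom:
  assumes K: "is_lsps K" and L: "is_lsps L" and \<phi>: "\<phi> \<in> lsps_hom K L"
  shows "T_mor K L \<phi> \<in> whdts_hom (T_obj K) (T_obj L)"
proof -
  note H = lsps_homD[OF \<phi>]
  have "\<exists>!h. h \<in> whdts_hom (T_obj K) (T_obj L) \<and>
     (\<forall>n. \<forall>x\<in>cubes K n. whdts_comp (Cn (lab K n x)) h (T_coproj K n x) = T_coproj L n (\<phi> n x))"
  proof (rule T_obj_universal[OF K is_whdts_T_obj[OF L]])
    show "T_coproj L n (\<phi> n x) \<in> whdts_hom (Cn (lab K n x)) (T_obj L)" if "x \<in> cubes K n" for n x
      using T_coproj_cocone(1)[OF L H(1)[OF that]] H(3)[OF that] by simp
    show "whdts_comp (Cn (pull words m n f (lab K n x))) (T_coproj L n (\<phi> n x)) (Cn_map m f (lab K n x))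
       = T_coproj L m (\<phi> m (pull K m n f x))" if "box_mor m n f" "x \<in> cubes K n" for m n f x
      using T_coproj_cocone(2)[OF L that(1) H(1)[OF that(2)]] H(3)[OF that(2)] H(2)[OF that] by simp
  qed
  then obtain h where h: "h \<in> whdts_hom (T_obj K) (T_obj L)"
    and hc: "\<And>n x. x \<in> cubes K n \<Longrightarrow>
      whdts_comp (Cn (lab K n x)) h (T_coproj K n x) = T_coproj L n (\<phi> n x)" by blast
  have h': "(fst h, snd h) \<in> whdts_hom (T_obj K) (T_obj L)" using h by simp
  have hs: "fst h (fst (T_coproj K n x) s) = fst (T_coproj L n (\<phi> n x)) s"
    if "x \<in> cubes K n" "s \<in> cube (length (lab K n x))" for n x s
    using arg_cong[OF hc[OF that(1)], of "\<lambda>h. fst h s"] that(2) by (simp add: whdts_comp_def compose_def)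
  have ha: "snd h (snd (T_coproj K n x) s) = snd (T_coproj L n (\<phi> n x)) s"
    if "x \<in> cubes K n" "s \<in> actions (Cn (lab K n x))" for n x s
    using arg_cong[OF hc[OF that(1)], of "\<lambda>h. snd h s"] that(2)
    by (simp add: whdts_comp_def compose_def del: Cn_simps(2))
  have "T_mor K L \<phi> = h"
  proof (rule prod_eqI; rule ext)
    fix c
    show "fst (T_mor K L \<phi>) c = fst h c"
    proof (cases "c \<in> states (T_obj K)")
      case True
      then obtain n x s where "x \<in> cubes K n" "s \<in> cube (length (lab K n x))" "c = fst (T_coproj K n x) s"
        unfolding T_obj_carriers by blast
      then show ?thesis using T_mor_class(1)[OF K L \<phi>] hs by simp
    next
      case False
      then show ?thesis using PiE_arb[OF whdts_homD(1)[OF h'] False] by (simp add: T_mor_def)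
    qed
  next
    fix c
    show "snd (T_mor K L \<phi>) c = snd h c"
    proof (cases "c \<in> actions (T_obj K)")
      case True
      then obtain n x s where "x \<in> cubes K n" "s \<in> actions (Cn (lab K n x))" "c = snd (T_coproj K n x) s"
        unfolding T_obj_carriers by blast
      then show ?thesis using T_mor_class(2)[OF K L \<phi>] ha by (simp del: Cn_simps(2))
    next
      case False
      then show ?thesis using PiE_arb[OF whdts_homD(2)[OF h'] False] by (simp add: T_mor_def)
    qed
  qed
  then show ?thesis using h by simp
qed

lemma T_mor_id:
  assumes K: "is_lsps K"
  shows "T_mor K K (sps_id K) = whdts_id (T_obj K)"
proof (rule T_hom_ext[OF K is_whdts_T_obj[OF K]])
  show "T_mor K K (sps_id K) \<in> whdts_hom (T_obj K) (T_obj K)"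
    by (intro T_mor_hom K lsps_id_hom)
  show "whdts_id (T_obj K) \<in> whdts_hom (T_obj K) (T_obj K)"
    by (intro whdts_id_hom is_whdts_T_obj K)
  fix n x assume x: "x \<in> cubes K n"
  show "whdts_comp (Cn (lab K n x)) (T_mor K K (sps_id K)) (T_coproj K n x) =
      whdts_comp (Cn (lab K n x)) (whdts_id (T_obj K)) (T_coproj K n x)"
    using T_mor_coproj[OF K K lsps_id_hom[OF K] x] x
      whdts_comp_id(2)[OF T_coproj_cocone(1)[OF K x]] by (simp add: sps_id_def)
qed

lemma T_mor_comp:
  assumes K: "is_lsps K" and L: "is_lsps L" and M: "is_lsps M"
    and \<phi>: "\<phi> \<in> lsps_hom K L" and \<psi>: "\<psi> \<in> lsps_hom L M"
  shows "T_mor K M (sps_comp K \<psi> \<phi>) = whdts_comp (T_obj K) (T_mor L M \<psi>) (T_mor K L \<phi>)"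
proof (rule T_hom_ext[OF K is_whdts_T_obj[OF M]])
  note \<psi>\<phi> = lsps_comp_hom[OF K \<phi> \<psi>]
  show "T_mor K M (sps_comp K \<psi> \<phi>) \<in> whdts_hom (T_obj K) (T_obj M)" by (rule T_mor_hom[OF K M \<psi>\<phi>])
  show "whdts_comp (T_obj K) (T_mor L M \<psi>) (T_mor K L \<phi>) \<in> whdts_hom (T_obj K) (T_obj M)"
    by (rule whdts_comp_hom[OF is_whdts_T_obj[OF K] T_mor_hom[OF K L \<phi>] T_mor_hom[OF L M \<psi>]])
  fix n x assume x: "x \<in> cubes K n"
  note y = lsps_homD(1)[OF \<phi> x]
  have "whdts_comp (Cn (lab K n x)) (T_mor K M (sps_comp K \<psi> \<phi>)) (T_coproj K n x)
      = T_coproj M n (\<psi> n (\<phi> n x))"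
    using T_mor_coproj[OF K M \<psi>\<phi> x] x by (simp add: sps_comp_def compose_def)
  also have "\<dots> = whdts_comp (Cn (lab K n x)) (T_mor L M \<psi>) (T_coproj L n (\<phi> n x))"
    using T_mor_coproj[OF L M \<psi> y] lsps_homD(3)[OF \<phi> x] by simp
  also have "\<dots> = whdts_comp (Cn (lab K n x)) (whdts_comp (T_obj K) (T_mor L M \<psi>) (T_mor K L \<phi>))
      (T_coproj K n x)"
    using whdts_comp_assoc[OF T_coproj_cocone(1)[OF K x], of "T_mor L M \<psi>" "T_mor K L \<phi>"]
      T_mor_coproj[OF K L \<phi> x] by simp
  finally show "whdts_comp (Cn (lab K n x)) (T_mor K M (sps_comp K \<psi> \<phi>)) (T_coproj K n x) =
    whdts_comp (Cn (lab K n x)) (whdts_comp (T_obj K) (T_mor L M \<psi>) (T_mor K L \<phi>)) (T_coproj K n x)" .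
qed

lemma is_functor_TT: "is_functor LSPS WHDTS TT"
  by (simp add: is_functor_def LSPS_def WHDTS_def TT_def is_whdts_T_obj T_mor_hom T_mor_id T_mor_comp)

lemma is_functor_full_subcategory:
  "is_functor C D F \<Longrightarrow> is_functor (full_subcategory C P) D F"
  by (auto simp: is_functor_def full_subcategory_def)

lemma is_functor_TT_HDA: "is_functor HDA WHDTS TT"
  unfolding HDA_def by (rule is_functor_full_subcategory[OF is_functor_TT])


text \<open>On labelled cubes the functor is, up to a natural isomorphism, \<open>Cn\<close> and \<open>Cn_map\<close>.\<close>

definition cube_iso :: "'a list \<Rightarrow>
    (bool list \<Rightarrow> ((nat \<times> (bool list \<Rightarrow> bool list)) \<times> bool list) set) \<times>
    ('a \<times> nat \<Rightarrow> ((nat \<times> (bool list \<Rightarrow> bool list)) \<times> ('a \<times> nat)) set)" where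
  "cube_iso a = T_coproj (labelled_cube a) (length a) (\<lambda>e\<in>cube (length a). e)"

lemma labelled_cube_simps:
  "cubes (labelled_cube a) k = box k (length a)"
  "pull (labelled_cube a) k l f g = compose (cube k) g f"
  "box_mor k (length a) f \<Longrightarrow> lab (labelled_cube a) k f = pull words k (length a) f a"
  by (simp_all add: labelled_cube_def rep_def)

lemma pull_words_ident: "pull words (length a) (length a) (\<lambda>e\<in>cube (length a). e) a = a"
  using is_spsD(2)[OF is_sps_words, of a "length a"] by (simp add: words_def)

lemma cube_iso:
  "cube_iso a \<in> whdts_hom (Cn a) (T_obj (labelled_cube a)) \<and>
   (\<exists>h\<in>whdts_hom (T_obj (labelled_cube a)) (Cn a).
      whdts_comp (Cn a) h (cube_iso a) = whdts_id (Cn a) \<and>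
      whdts_comp (T_obj (labelled_cube a)) (cube_iso a) h = whdts_id (T_obj (labelled_cube a)))"
proof
  let ?K = "labelled_cube a"
  let ?n = "length a"
  let ?i = "\<lambda>e\<in>cube ?n. e"
  note K = is_lsps_labelled_cube[of a]
  have i: "?i \<in> cubes ?K ?n" by (simp add: labelled_cube_simps box_mor.ident)
  have li: "lab ?K ?n ?i = a" by (simp add: labelled_cube_simps box_mor.ident pull_words_ident)
  show c: "cube_iso a \<in> whdts_hom (Cn a) (T_obj ?K)"
    using T_coproj_cocone(1)[OF K i] by (simp add: cube_iso_def li)
  have "\<exists>!h. h \<in> whdts_hom (T_obj ?K) (Cn a) \<and>
     (\<forall>n. \<forall>x\<in>cubes ?K n. whdts_comp (Cn (lab ?K n x)) h (T_coproj ?K n x) = Cn_map n x a)"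
  proof (rule T_obj_universal[OF K is_whdts_Cn])
    show "Cn_map n x a \<in> whdts_hom (Cn (lab ?K n x)) (Cn a)" if "x \<in> cubes ?K n" for n x
      using that Cn_map_hom[of n a x] by (simp add: labelled_cube_simps)
    show "whdts_comp (Cn (pull words m n f (lab ?K n x))) (Cn_map n x a) (Cn_map m f (lab ?K n x))
       = Cn_map m (pull ?K m n f x) a" if "box_mor m n f" "x \<in> cubes ?K n" for m n f x
      using that Cn_map_comp[of m n f a x] by (simp add: labelled_cube_simps)
  qed
  then obtain h where h: "h \<in> whdts_hom (T_obj ?K) (Cn a)"
    and hc: "\<And>n x. x \<in> cubes ?K n \<Longrightarrow>
      whdts_comp (Cn (lab ?K n x)) h (T_coproj ?K n x) = Cn_map n x a" by blast
  have 1: "whdts_comp (Cn a) h (cube_iso a) = whdts_id (Cn a)"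
    using hc[OF i] by (simp add: cube_iso_def li Cn_map_ident)
  have 2: "whdts_comp (T_obj ?K) (cube_iso a) h = whdts_id (T_obj ?K)"
  proof (rule T_hom_ext[OF K is_whdts_T_obj[OF K]])
    show "whdts_comp (T_obj ?K) (cube_iso a) h \<in> whdts_hom (T_obj ?K) (T_obj ?K)"
      by (rule whdts_comp_hom[OF is_whdts_T_obj[OF K] h c])
    show "whdts_id (T_obj ?K) \<in> whdts_hom (T_obj ?K) (T_obj ?K)"
      by (intro whdts_id_hom is_whdts_T_obj K)
    fix n x assume x: "x \<in> cubes ?K n"
    then have bx: "box_mor n ?n x" by (simp add: labelled_cube_simps)
    have "whdts_comp (Cn (lab ?K n x)) (whdts_comp (T_obj ?K) (cube_iso a) h) (T_coproj ?K n x)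
        = whdts_comp (Cn (lab ?K n x)) (cube_iso a) (Cn_map n x a)"
      using whdts_comp_assoc[OF T_coproj_cocone(1)[OF K x], of "cube_iso a" h] hc[OF x] by simp
    also have "\<dots> = T_coproj ?K n (pull ?K n ?n x ?i)"
      using T_coproj_cocone(2)[OF K bx i] bx by (simp add: cube_iso_def li labelled_cube_simps(3))
    also have "pull ?K n ?n x ?i = x"
      using compose_ident_left[OF box_mor_map[OF bx]] by (simp add: labelled_cube_simps)
    also have "T_coproj ?K n x = whdts_comp (Cn (lab ?K n x)) (whdts_id (T_obj ?K)) (T_coproj ?K n x)"
      using whdts_comp_id(2)[OF T_coproj_cocone(1)[OF K x]] by simp
    finally show "whdts_comp (Cn (lab ?K n x)) (whdts_comp (T_obj ?K) (cube_iso a) h) (T_coproj ?K n x)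
      = whdts_comp (Cn (lab ?K n x)) (whdts_id (T_obj ?K)) (T_coproj ?K n x)" .
  qed
  show "\<exists>h\<in>whdts_hom (T_obj ?K) (Cn a).
      whdts_comp (Cn a) h (cube_iso a) = whdts_id (Cn a) \<and>
      whdts_comp (T_obj ?K) (cube_iso a) h = whdts_id (T_obj ?K)"
    using h 1 2 by blast
qed

definition cube_map :: "nat \<Rightarrow> (bool list \<Rightarrow> bool list)
    \<Rightarrow> nat \<Rightarrow> (bool list \<Rightarrow> bool list) \<Rightarrow> (bool list \<Rightarrow> bool list)" where
  "cube_map m f = (\<lambda>k. \<lambda>g\<in>box k m. compose (cube k) f g)"

lemma cube_map_hom:
  assumes f: "box_mor m (length b) f"
  shows "cube_map m f \<in> lsps_hom (labelled_cube (pull words m (length b) f b)) (labelled_cube b)"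
proof -
  have "compose (cube k) f (compose (cube k) g h) = compose (cube k) (compose (cube l) f g) h"
    if "box_mor k l h" for k l g h
    using box_mor_map[OF that] by (intro compose_assoc_ext[symmetric]) auto
  then show ?thesis
    using f is_spsD(3)[OF is_sps_words _ f, of _ _ b]
    by (auto simp: lsps_hom_def sps_hom_def labelled_cube_simps cube_map_def box_mor.comp words_def)
qed

lemma cube_iso_natural:
  assumes f: "box_mor m (length b) f"
  defines "a \<equiv> pull words m (length b) f b"
  shows "whdts_comp (Cn a) (T_mor (labelled_cube a) (labelled_cube b) (cube_map m f)) (cube_iso a)
    = whdts_comp (Cn a) (cube_iso b) (Cn_map m f b)"
proof -
  let ?i = "\<lambda>e\<in>cube m. e" and ?j = "\<lambda>e\<in>cube (length b). e"
  have la: "length a = m" by (simp add: a_def)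
  have i: "?i \<in> cubes (labelled_cube a) m" by (simp add: labelled_cube_simps la box_mor.ident)
  have j: "?j \<in> cubes (labelled_cube b) (length b)" by (simp add: labelled_cube_simps box_mor.ident)
  have li: "lab (labelled_cube a) m ?i = a"
    using pull_words_ident[of a] by (simp add: labelled_cube_simps la box_mor.ident)
  have lj: "lab (labelled_cube b) (length b) ?j = b"
    using pull_words_ident[of b] by (simp add: labelled_cube_simps box_mor.ident)
  have cf: "cube_map m f m ?i = f"
    using compose_ident_right[of f "cube m"] box_mor_map[OF f]
    by (simp add: cube_map_def box_mor.ident PiE_def)
  have "pull (labelled_cube b) m (length b) f ?j = f"
    using compose_ident_left[OF box_mor_map[OF f]] by (simp add: labelled_cube_simps)
  then have "whdts_comp (Cn a) (cube_iso b) (Cn_map m f b) = T_coproj (labelled_cube b) m f"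
    using T_coproj_cocone(2)[OF is_lsps_labelled_cube f j] by (simp add: lj cube_iso_def a_def)
  then show ?thesis
    using T_mor_coproj[OF is_lsps_labelled_cube is_lsps_labelled_cube cube_map_hom[OF f, folded a_def] i]
    by (simp add: li cf cube_iso_def la)
qed


text \<open>
  The functor has a right adjoint, so it preserves all colimits: \<open>transpose\<close> is a bijection
  \<open>Hom(T(K), X) \<cong> Hom(K, nerve X)\<close>, natural in \<open>K\<close>.
\<close>

definition nerve :: "('s, 'l, 'a) whdts
    \<Rightarrow> ('a list \<times> ((bool list \<Rightarrow> 's) \<times> ('a \<times> nat \<Rightarrow> 'l)), 'a) lsps" where
  "nerve X = \<lparr>cubes = (\<lambda>n. {(w, h). length w = n \<and> h \<in> whdts_hom (Cn w) X}),
     pull = (\<lambda>m n f (w, h). (pull words m n f w,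
        whdts_comp (Cn (pull words m n f w)) h (Cn_map m f w))),
     lab = (\<lambda>n. \<lambda>x\<in>{(w, h). length w = n \<and> h \<in> whdts_hom (Cn w) X}. fst x)\<rparr>"

definition transpose where
  "transpose K h = (\<lambda>n. \<lambda>x\<in>cubes K n. (lab K n x, whdts_comp (Cn (lab K n x)) h (T_coproj K n x)))"

lemma is_lsps_nerve:
  fixes X :: "('s, 'l, 'a) whdts"
  shows "is_lsps (nerve X)"
proof -
  have w: "pull words n n (\<lambda>e\<in>cube n. e) w = w" if "length w = n" for n and w :: "'a list"
    using pull_words_ident[of w] that by simp
  have c: "pull words k n (compose (cube k) g f) w = pull words k m f (pull words m n g w)"
    if "box_mor k m f" "box_mor m n g" "length w = n" for k m n f g and w :: "'a list"
    using is_spsD(3)[OF is_sps_words that(1,2), of w] that(3) by (simp add: words_def)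
  have h: "whdts_comp (Cn (pull words m n f w)) h (Cn_map m f w) \<in> whdts_hom (Cn (pull words m n f w)) X"
    if "box_mor m n f" "length w = n" "h \<in> whdts_hom (Cn w) X" for m n f w h
    using whdts_comp_hom[OF is_whdts_Cn Cn_map_hom that(3), of m f] that by simp
  have i: "whdts_comp (Cn w) h (Cn_map n (\<lambda>e\<in>cube n. e) w) = h"
    if "length w = n" "h \<in> whdts_hom (Cn w) X" for n w h
    using whdts_comp_id(1)[OF that(2)] Cn_map_ident[of w] that by simp
  have s: "whdts_comp (Cn (pull words k m f (pull words m n g w))) h (Cn_map k (compose (cube k) g f) w)
      = whdts_comp (Cn (pull words k m f (pull words m n g w)))
          (whdts_comp (Cn (pull words m n g w)) h (Cn_map m g w)) (Cn_map k f (pull words m n g w))"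
    if "box_mor k m f" "box_mor m n g" "length w = n" for k m n f g w and h :: "(bool list \<Rightarrow> 's) \<times> ('a \<times> nat \<Rightarrow> 'l)"
    using Cn_map_comp[OF that(1), of w g] whdts_comp_assoc[OF Cn_map_hom[of k "pull words m n g w" f], of h "Cn_map m g w"] that
    by simp
  show ?thesis
    by (auto simp: is_lsps_def is_sps_def sps_hom_def nerve_def words_def[THEN arg_cong[of _ _ cubes]]
        w c h i s)
qed

lemma adjunction:
  assumes K: "is_lsps K" and X: "is_whdts X"
  shows "bij_betw (transpose K) (whdts_hom (T_obj K) X) (lsps_hom K (nerve X))"
proof (rule bij_betwI')
  fix h h' assume h: "h \<in> whdts_hom (T_obj K) X" and h': "h' \<in> whdts_hom (T_obj K) X"
  show "transpose K h = transpose K h' \<longleftrightarrow> h = h'"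
  proof
    assume eq: "transpose K h = transpose K h'"
    show "h = h'"
    proof (rule T_hom_ext[OF K X h h'])
      fix n x assume "x \<in> cubes K n"
      then show "whdts_comp (Cn (lab K n x)) h (T_coproj K n x) = whdts_comp (Cn (lab K n x)) h' (T_coproj K n x)"
        using fun_cong[OF fun_cong[OF eq, of n], of x] by (simp add: transpose_def)
    qed
  qed simp
next
  fix h assume h: "h \<in> whdts_hom (T_obj K) X"
  have a: "whdts_comp (Cn (lab K n x)) h (T_coproj K n x) \<in> whdts_hom (Cn (lab K n x)) X"
    if "x \<in> cubes K n" for n x
    by (rule whdts_comp_hom[OF is_whdts_Cn T_coproj_cocone(1)[OF K that] h])
  have b: "whdts_comp (Cn (pull words m n f (lab K n x)))
        (whdts_comp (Cn (lab K n x)) h (T_coproj K n x)) (Cn_map m f (lab K n x))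
      = whdts_comp (Cn (pull words m n f (lab K n x))) h (T_coproj K m (pull K m n f x))"
    if "box_mor m n f" "x \<in> cubes K n" for m n f x
    using whdts_comp_assoc[OF Cn_map_hom[of m "lab K n x" f], of h "T_coproj K n x"] T_coproj_cocone(2)[OF K that]
      is_lspsD(2)[OF K that(2)] that(1) by simp
  show "transpose K h \<in> lsps_hom K (nerve X)"
    using a b is_lspsD[OF K] is_spsD(1)[OF is_lspsD(1)[OF K]]
    by (auto simp: lsps_hom_def sps_hom_def nerve_def transpose_def)
next
  fix \<theta> assume \<theta>: "\<theta> \<in> lsps_hom K (nerve X)"
  have t: "fst (\<theta> n x) = lab K n x" "snd (\<theta> n x) \<in> whdts_hom (Cn (lab K n x)) X" if "x \<in> cubes K n" for n x
    using lsps_homD(1,3)[OF \<theta> that] by (auto simp: nerve_def)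
  have "\<exists>!h. h \<in> whdts_hom (T_obj K) X \<and>
     (\<forall>n. \<forall>x\<in>cubes K n. whdts_comp (Cn (lab K n x)) h (T_coproj K n x) = snd (\<theta> n x))"
  proof (rule T_obj_universal[OF K X])
    show "snd (\<theta> n x) \<in> whdts_hom (Cn (lab K n x)) X" if "x \<in> cubes K n" for n x by (rule t(2)[OF that])
    show "whdts_comp (Cn (pull words m n f (lab K n x))) (snd (\<theta> n x)) (Cn_map m f (lab K n x))
       = snd (\<theta> m (pull K m n f x))" if "box_mor m n f" "x \<in> cubes K n" for m n f x
      using lsps_homD(2)[OF \<theta> that] t(1)[OF that(2)] by (simp add: nerve_def case_prod_beta)
  qed
  then obtain h where h: "h \<in> whdts_hom (T_obj K) X"
    and hc: "\<And>n x. x \<in> cubes K n \<Longrightarrow>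
      whdts_comp (Cn (lab K n x)) h (T_coproj K n x) = snd (\<theta> n x)" by blast
  have "\<theta> n x = transpose K h n x" for n x
  proof (cases "x \<in> cubes K n")
    case True
    then show ?thesis using hc[OF True] t(1)[OF True] by (simp add: transpose_def prod_eq_iff)
  next
    case False
    have "\<theta> n \<in> cubes K n \<rightarrow>\<^sub>E cubes (nerve X) n" by (rule sps_homD(1)[OF lsps_hom_sps[OF \<theta>]])
    then show ?thesis using False PiE_arb by (fastforce simp: transpose_def)
  qed
  then have "\<theta> = transpose K h" by (intro ext)
  with h show "\<exists>h\<in>whdts_hom (T_obj K) X. \<theta> = transpose K h" by blast
qed

lemma adjunction_natural:
  assumes K: "is_lsps K" and L: "is_lsps L" and \<phi>: "\<phi> \<in> lsps_hom K L"
  shows "transpose K (whdts_comp (T_obj K) h (T_mor K L \<phi>)) = sps_comp K (transpose L h) \<phi>"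
proof (intro ext)
  fix n x
  show "transpose K (whdts_comp (T_obj K) h (T_mor K L \<phi>)) n x = sps_comp K (transpose L h) \<phi> n x"
  proof (cases "x \<in> cubes K n")
    case True
    then show ?thesis
      using whdts_comp_assoc[OF T_coproj_cocone(1)[OF K True], of h "T_mor K L \<phi>"] T_mor_coproj[OF K L \<phi> True] lsps_homD[OF \<phi>]
      by (simp add: transpose_def sps_comp_def compose_def)
  qed (simp add: transpose_def sps_comp_def compose_def)
qed

end

theory Submission
  imports Defs
begin

text \<open>
  The functor does not see the difference between two loops that are opposite faces of a square:
  both become the same transition, since they have the same end points and the same action.

  Let \<open>L\<close> have one vertex, two loops \<open>x\<close> and \<open>y\<close>, and one square, whose two faces at \<open>0\<close> are \<open>x\<close>
  and whose two faces at \<open>1\<close> are \<open>y\<close>, and let \<open>K\<close> be its quotient by \<open>x = y\<close>.  All edges carry the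
  same label.  In both cases the transition system has one state and one action \<open>u\<close>, with
  transitions \<open>u\<close> and \<open>(u, u)\<close>, and so there is a morphism \<open>T(K) \<rightarrow> T(L)\<close>.  But there is no map
  \<open>K \<rightarrow> L\<close>: it would send the square to the square, and then the only edge of \<open>K\<close> to both
  \<open>x\<close> and \<open>y\<close>.

  The morphism is found without computing \<open>T(L)\<close>: two cubes of \<open>L\<close> of the same dimension have the
  same image in the colimit (\<open>T_coproj_loop_square\<close>), so that the coprojections of \<open>L\<close> are also a
  cocone on the cubes of \<open>K\<close>.  The HDA paradigm holds because \<open>K\<close> and \<open>L\<close> have at most one
  \<open>p\<close>-cube for each \<open>p \<ge> 2\<close>.
\<close>

lemma hda_paradigm_if_unique_cubes:
  assumes "\<And>p u v. p \<ge> 2 \<Longrightarrow> u \<in> cubes K p \<Longrightarrow> v \<in> cubes K p \<Longrightarrow> u = v"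
  shows "hda_paradigm K"
  unfolding hda_paradigm_def
proof (intro allI ballI impI)
  fix p :: nat and \<phi> \<psi> \<theta> \<theta>'
  assume p: "p \<ge> 2" and l: "\<theta> \<in> hda_lifts K p \<phi> \<psi>" "\<theta>' \<in> hda_lifts K p \<phi> \<psi>"
  then have h: "\<theta> \<in> sps_hom (rep p) K" "\<theta>' \<in> sps_hom (rep p) K"
    and eq: "sps_comp (boundary p) \<theta> (sps_id (boundary p)) = sps_comp (boundary p) \<theta>' (sps_id (boundary p))"
    by (auto simp: hda_lifts_def)
  show "\<theta> = \<theta>'"
  proof
    fix n
    show "\<theta> n = \<theta>' n"
    proof (rule PiE_ext[OF sps_homD(1)[OF h(1)] sps_homD(1)[OF h(2)]])
      fix f assume f: "f \<in> cubes (rep p) n"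
      then have "n \<le> p" by (auto simp: rep_def dest: box_mor_le)
      then consider "n < p" | "n = p" by linarith
      then show "\<theta> n f = \<theta>' n f"
      proof cases
        case 1
        then show ?thesis using fun_cong[OF fun_cong[OF eq, of n], of f] f
          by (simp add: sps_comp_def sps_id_def compose_def boundary_def rep_def)
      next
        case 2
        then show ?thesis using assms[OF p] sps_homD(2)[OF h(1) f] sps_homD(2)[OF h(2) f] by blast
      qed
    qed
  qed
qed

text \<open>
  Endomorphisms of a cube permute coordinates; so they preserve the property of having some
  coordinate \<open>1\<close>, which tells the edges of a square at \<open>1\<close> from those at \<open>0\<close>.
\<close>

lemma set_box_endomorphism: "box_mor m n f \<Longrightarrow> m = n \<Longrightarrow> e \<in> cube m \<Longrightarrow> set (f e) = set e"
proof (induction arbitrary: e rule: box_mor.induct)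
  case (symm i n)
  then show ?case by (simp add: symm_def cube_def set_swap)
next
  case (comp k m f n g)
  then have "k = m" "m = n" by (auto dest!: box_mor_le)
  with comp show ?case by (auto simp: compose_def box_mor_cube)
qed auto

text \<open>
  One vertex, edges \<open>x\<close> and \<open>y\<close>, and one square, whose faces at \<open>0\<close> are \<open>x\<close> and whose faces at
  \<open>1\<close> are \<open>y\<close>.  The vertex and the square are both named \<open>x\<close>, cubes of different dimensions being
  unrelated; the letter \<open>undefined\<close> is an arbitrary label.  An edge \<open>f\<close> of the square lies at \<open>1\<close>
  exactly when its initial vertex \<open>f [False]\<close> has a coordinate \<open>1\<close>.
\<close>

definition loop_square :: "'x \<Rightarrow> 'x \<Rightarrow> ('x, 'a) lsps" where
  "loop_square x y = \<lparr>
     cubes = (\<lambda>n. if n = 1 then {x, y} else if n \<le> 2 then {x} else {}),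
     pull = (\<lambda>m n f z. if m = n then z else if m = 1 \<and> True \<in> set (f [False]) then y else x),
     lab = (\<lambda>n. \<lambda>z\<in>if n = 1 then {x, y} else if n \<le> 2 then {x} else {}. replicate n undefined)\<rparr>"

lemma cubes_loop_square:
  "cubes (loop_square x y) n = (if n = 1 then {x, y} else if n \<le> 2 then {x} else {})"
  by (simp add: loop_square_def)

lemma lab_loop_square:
  fixes x y z :: 'x
  defines "L \<equiv> loop_square x y :: ('x, 'a) lsps"
  shows "z \<in> cubes L n \<Longrightarrow> lab L n z = replicate n undefined"
  by (simp add: L_def loop_square_def)

lemma pull_words_replicate:
  assumes "box_mor m n f"
  shows "pull words m n f (replicate n a) = replicate m a"
  by (rule nth_equalityI) (simp_all add: hat_inv_properties(1)[OF assms])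

lemma is_lsps_loop_square: "is_lsps (loop_square x y :: ('x, 'a) lsps)"
proof -
  let ?L = "loop_square x y :: ('x, 'a) lsps"
  have pull: "pull ?L m n f z \<in> cubes ?L m" if "box_mor m n f" "z \<in> cubes ?L n" for m n f z
    using that box_mor_le[OF that(1)] by (auto simp: loop_square_def split: if_splits)
  have comp: "pull ?L k n (compose (cube k) g f) z = pull ?L k m f (pull ?L m n g z)"
    if f: "box_mor k m f" and g: "box_mor m n g" and z: "z \<in> cubes ?L n" for k m n f g z
  proof -
    have le: "k \<le> m" "m \<le> n" "n \<le> 2"
      using box_mor_le[OF f] box_mor_le[OF g] z by (auto simp: cubes_loop_square split: if_splits)
    have c: "compose (cube k) g f [False] = g (f [False])" if "k = 1"
      using that by (simp add: compose_def cube_def)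
    consider "k = n" | "k \<noteq> 1" "k \<noteq> n" | "k = 1" "n = 2" "m = 1" | "k = 1" "n = 2" "m = 2"
      using le by linarith
    then show ?thesis
    proof cases
      case 3
      then have "length (f [False]) = 1" "set (f [False]) = {False}"
        using box_mor_cube[OF f, of "[False]"] set_box_endomorphism[OF f, of "[False]"]
        by (simp_all add: cube_def)
      then have "f [False] = [False]" by (cases "f [False]") simp_all
      with 3 c show ?thesis by (simp add: loop_square_def)
    next
      case 4
      then have "set (g (f [False])) = set (f [False])"
        using box_mor_cube[OF f, of "[False]"] set_box_endomorphism[OF g, of "f [False]"]
        by (simp add: cube_def)
      with 4 c show ?thesis by (simp add: loop_square_def)
    qed (use le in \<open>auto simp: loop_square_def\<close>)
  qed
  have ident: "pull ?L n n (\<lambda>e\<in>cube n. e) z = z" for n z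
    by (simp add: loop_square_def)
  have "is_sps ?L"
    unfolding is_sps_def using pull ident comp by (intro conjI allI ballI) (simp_all only: mem_Collect_eq)
  moreover have "lab ?L \<in> sps_hom ?L words"
    unfolding sps_hom_def
  proof (intro CollectI conjI allI ballI)
    fix n show "lab ?L n \<in> cubes ?L n \<rightarrow>\<^sub>E cubes words n"
      by (auto simp: loop_square_def words_def)
  next
    fix m n f z assume "f \<in> box m n" "z \<in> cubes ?L n"
    then show "lab ?L m (pull ?L m n f z) = pull words m n f (lab ?L n z)"
      using pull by (simp add: lab_loop_square pull_words_replicate)
  qed
  ultimately show ?thesis by (simp add: is_lsps_def)
qed

lemma hda_paradigm_loop_square: "hda_paradigm (loop_square x y)"
  by (rule hda_paradigm_if_unique_cubes) (auto simp: cubes_loop_square split: if_splits)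

text \<open>
  The loops \<open>x\<close> and \<open>y\<close> have the same image: the state is the only one, and the action is that of
  the second coordinate of the square, of which both are the faces with the first coordinate fixed.
\<close>

lemma T_coproj_loop_square:
  fixes x y u v :: 'x
  defines "L \<equiv> loop_square x y :: ('x, 'a) lsps"
  assumes "u \<in> cubes L n" "v \<in> cubes L n"
  shows "T_coproj L n u = T_coproj L n v"
proof -
  have L: "is_lsps L" by (simp add: L_def is_lsps_loop_square)
  let ?a = "undefined :: 'a"
  have x: "x \<in> cubes L 2" by (simp add: L_def cubes_loop_square)
  have edge: "z \<in> cubes L 1" "lab L 1 z = [?a]" if "z \<in> {x, y}" for z
    using that by (simp_all add: L_def cubes_loop_square lab_loop_square)
  have st: "fst (T_coproj L 1 z) s = fst (T_coproj L 0 x) []" if z: "z \<in> {x, y}" and s: "s \<in> cube 1" for z s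
  proof -
    obtain b where b: "s = [b]" using s by (auto simp: cube_def length_Suc_conv)
    have f: "box_mor 0 1 (face 0 0 b)" using box_mor.face[of 0 0 b] by simp
    have "pull L 0 1 (face 0 0 b) z = x" by (simp add: L_def loop_square_def)
    from arg_cong[OF T_coproj_cocone(2)[OF L f edge(1)[OF z], unfolded this], of "\<lambda>h. fst h []"]
    have "fst (T_coproj L 0 x) [] = fst (T_coproj L 1 z) (face 0 0 b [])"
      by (simp add: whdts_comp_def compose_def Cn_map_simps cube_def)
    then show ?thesis by (simp add: b face_def cube_def)
  qed
  have ac: "snd (T_coproj L 1 (if b then y else x)) (?a, 0) = snd (T_coproj L 2 x) (?a, 1)" for b
  proof -
    have f: "box_mor 1 2 (face 1 0 b)" using box_mor.face[of 0 1 b] by (simp add: numeral_2_eq_2)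
    have h: "hat_inv 1 2 (face 1 0 b) 0 = 1"
      by (rule hat_inv_eqI[OF f]) (auto simp: face_def cube_def length_Suc_conv)
    have l: "lab L 2 x = replicate 2 ?a" using x by (simp add: L_def lab_loop_square)
    have "pull L 1 2 (face 1 0 b) x = (if b then y else x)"
      by (simp add: L_def loop_square_def face_def cube_def)
    from arg_cong[OF T_coproj_cocone(2)[OF L f x, unfolded this l pull_words_replicate[OF f]],
        of "\<lambda>h. snd h (?a, 0)"]
    have "snd (T_coproj L 1 (if b then y else x)) (?a, 0)
        = snd (T_coproj L 2 x) (snd (Cn_map 1 (face 1 0 b) (replicate 2 ?a)) (?a, 0))"
      by (simp add: whdts_comp_def compose_def)
    moreover have "snd (Cn_map 1 (face 1 0 b) (replicate 2 ?a)) (?a, 0) = (?a, 1)"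
      using Cn_map_simps(2)[of 0 1 "face 1 0 b" "replicate 2 ?a"] h by simp
    ultimately show ?thesis by simp
  qed
  have hom: "(fst (T_coproj L 1 z), snd (T_coproj L 1 z)) \<in> whdts_hom (Cn [?a]) (T_obj L)"
    if "z \<in> {x, y}" for z
    using T_coproj_cocone(1)[OF L edge(1)[OF that]] edge(2)[OF that] by simp
  have eq: "T_coproj L 1 z = T_coproj L 1 x" if z: "z \<in> {x, y}" for z
  proof (rule prod_eqI)
    have hx: "x \<in> {x, y}" by simp
    show "fst (T_coproj L 1 z) = fst (T_coproj L 1 x)"
    proof (rule PiE_ext[OF whdts_homD(1)[OF hom[OF z]] whdts_homD(1)[OF hom[OF hx]]])
      fix s assume "s \<in> states (Cn [?a])"
      then have "s \<in> cube 1" by (simp add: Cn_def)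
      then show "fst (T_coproj L 1 z) s = fst (T_coproj L 1 x) s"
        by (simp only: st[OF z] st[OF hx])
    qed
    show "snd (T_coproj L 1 z) = snd (T_coproj L 1 x)"
    proof (rule PiE_ext[OF whdts_homD(2)[OF hom[OF z]] whdts_homD(2)[OF hom[OF hx]]])
      fix u assume "u \<in> actions (Cn [?a])"
      then have u: "u = (?a, 0)" by (simp add: Cn_def)
      have "snd (T_coproj L 1 w) u = snd (T_coproj L 2 x) (?a, 1)" if "w \<in> {x, y}" for w
        using that ac[of True] ac[of False] by (auto simp only: u insert_iff empty_iff if_True if_False)
      then show "snd (T_coproj L 1 z) u = snd (T_coproj L 1 x) u"
        using z hx by metis
    qed
  qed
  show ?thesis
  proof (cases "n = 1")
    case True
    then show ?thesis using assms(2,3) eq[of u] eq[of v] by (simp add: L_def cubes_loop_square)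
  next
    case False
    then have "u = v" using assms(2,3) by (simp add: L_def cubes_loop_square split: if_splits)
    then show ?thesis by simp
  qed
qed

lemma T_hom_loop_square:
  "whdts_hom (T_obj (loop_square x x :: ('x, 'a) lsps)) (T_obj (loop_square x y :: ('x, 'a) lsps)) \<noteq> {}"
proof -
  let ?K = "loop_square x x :: ('x, 'a) lsps" and ?L = "loop_square x y :: ('x, 'a) lsps"
  note K = is_lsps_loop_square[of x x] and L = is_lsps_loop_square[of x y]
  have sub: "z \<in> cubes ?L n" if "z \<in> cubes ?K n" for z n
    using that by (auto simp: cubes_loop_square split: if_splits)
  have lab: "lab ?K n z = lab ?L n z" if "z \<in> cubes ?K n" for z n
    using lab_loop_square[OF that] lab_loop_square[OF sub[OF that]] by simp
  have "\<exists>!h. h \<in> whdts_hom (T_obj ?K) (T_obj ?L) \<and>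
     (\<forall>n. \<forall>z\<in>cubes ?K n. whdts_comp (Cn (lab ?K n z)) h (T_coproj ?K n z) = T_coproj ?L n z)"
  proof (rule T_obj_universal[OF K is_whdts_T_obj[OF L]])
    show "T_coproj ?L n z \<in> whdts_hom (Cn (lab ?K n z)) (T_obj ?L)" if "z \<in> cubes ?K n" for n z
      using T_coproj_cocone(1)[OF L sub[OF that]] by (simp add: lab[OF that])
  next
    fix m n f z assume f: "box_mor m n f" and z: "z \<in> cubes ?K n"
    have "T_coproj ?L m (pull ?L m n f z) = T_coproj ?L m (pull ?K m n f z)"
      by (intro T_coproj_loop_square sub is_spsD(1)[OF is_lspsD(1)[OF K] f z]
          is_spsD(1)[OF is_lspsD(1)[OF L] f sub[OF z]])
    then show "whdts_comp (Cn (pull words m n f (lab ?K n z))) (T_coproj ?L n z) (Cn_map m f (lab ?K n z))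
        = T_coproj ?L m (pull ?K m n f z)"
      using T_coproj_cocone(2)[OF L f sub[OF z]] by (simp add: lab[OF z])
  qed
  then have "\<exists>h. h \<in> whdts_hom (T_obj ?K) (T_obj ?L)" by (elim ex1E conjE) (rule exI)
  then show ?thesis by (simp only: ex_in_conv simp_thms)
qed

lemma no_lsps_hom_loop_square:
  fixes x y :: 'x
  defines "K \<equiv> loop_square x x :: ('x, 'a) lsps" and "L \<equiv> loop_square x y :: ('x, 'a) lsps"
  assumes "x \<noteq> y"
  shows "lsps_hom K L = {}"
proof (rule equals0I)
  fix \<phi> assume \<phi>: "\<phi> \<in> lsps_hom K L"
  have x: "x \<in> cubes K 2" by (simp add: K_def cubes_loop_square)
  have "\<phi> 1 x = (if b then y else x)" for b
  proof -
    have f: "box_mor 1 2 (face 1 0 b)" using box_mor.face[of 0 1 b] by (simp add: numeral_2_eq_2)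
    have "pull K 1 2 (face 1 0 b) x = x" by (simp add: K_def loop_square_def)
    then have "\<phi> 1 x = pull L 1 2 (face 1 0 b) (\<phi> 2 x)" using lsps_homD(2)[OF \<phi> f x] by simp
    then show ?thesis by (simp add: L_def loop_square_def face_def cube_def)
  qed
  from this[of True] this[of False] \<open>x \<noteq> y\<close> show False by simp
qed

theorem proposition10p3:
  assumes "infinite (UNIV :: 'x set)"
  shows "\<not> is_full (HDA :: (('x, 'a) lsps, nat \<Rightarrow> 'x \<Rightarrow> 'x) category) WHDTS TT"
proof
  assume full: "is_full (HDA :: (('x, 'a) lsps, nat \<Rightarrow> 'x \<Rightarrow> 'x) category) WHDTS TT"
  obtain x y :: 'x where xy: "x \<noteq> y"
    using ex_new_if_finite[OF assms, of "{undefined}"] by blast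
  let ?K = "loop_square x x :: ('x, 'a) lsps" and ?L = "loop_square x y :: ('x, 'a) lsps"
  have "?K \<in> Obj HDA" "?L \<in> Obj HDA"
    by (simp_all add: HDA_def full_subcategory_def LSPS_def is_lsps_loop_square hda_paradigm_loop_square)
  moreover have "Hom WHDTS (on_obj TT ?K) (on_obj TT ?L) \<noteq> {}"
    by (simp add: WHDTS_def TT_def T_hom_loop_square)
  ultimately have "Hom HDA ?K ?L \<noteq> {}" using full unfolding is_full_def by fast
  then show False
    by (simp add: HDA_def full_subcategory_def LSPS_def no_lsps_hom_loop_square[OF xy])
qed

end
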